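(* Let $d\ge 2$ be an integer and let $\varepsilon>0$. Then every free action of $\mathbb{Z}^d$ on the circle $\mathrm{S}^1$ by orientation-preserving diffeomorphisms of class $C^{1+1/d+\varepsilon}$ is minimal.
   Context: All transformations are orientation preserving. For $\tau\in(0,1)$, a diffeomorphism $f$ is of class $C^{1+\tau}$ if it is $C^1$ and its derivative is $\tau$-Hölder: there is $C<\infty$ with $|f'(x)-f'(y)|\le C|x-y|^{\tau}$ for all $x,y$ (for exponents $\tau\ge 1$ the class has its usual meaning and is contained in $C^{1+\sigma}$ for all $\sigma<1$). An action of $\mathbb{Z}^d$ on $\mathrm{S}^1$ is free if no nontrivial element of $\mathbb{Z}^d$ has a fixed point. It is minimal if every orbit is dense in $\mathrm{S}^1$. *)

theory Defs
  imports "HOL-Analysis.Analysis" "HOL-Algebra.Algebra"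
begin

section \<open>The circle and its diffeomorphisms\<close>

abbreviation unit_circle :: "complex set"
  where "unit_circle \<equiv> sphere 0 1"

definition is_lift :: "(real \<Rightarrow> real) \<Rightarrow> (complex \<Rightarrow> complex) \<Rightarrow> bool"
  where "is_lift F f \<longleftrightarrow>
    continuous_on UNIV F \<and> (\<forall>t. f (cis (2 * pi * t)) = cis (2 * pi * F t))"

definition Hoelder :: "real \<Rightarrow> (real \<Rightarrow> real) \<Rightarrow> bool"
  where "Hoelder s g \<longleftrightarrow> (\<exists>C. \<forall>x y. \<bar>g x - g y\<bar> \<le> C * \<bar>x - y\<bar> powr s)"

text \<open>
  Class \<open>C\<^sup>r\<close> for real \<open>r \<ge> 0\<close>, with the usual convention: for \<open>r = k + s\<close> with integral part \<open>k\<close>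
  and fractional part \<open>s\<close>, the function is \<open>k\<close> times continuously differentiable and, if \<open>s > 0\<close>,
  its \<open>k\<close>-th derivative is \<open>s\<close>-Hoelder. In particular integral \<open>r\<close> is the classical \<open>C\<^sup>k\<close>.
\<close>

definition C_class :: "real \<Rightarrow> (real \<Rightarrow> real) \<Rightarrow> bool"
  where "C_class r F \<longleftrightarrow>
    (\<forall>j < nat \<lfloor>r\<rfloor>. \<forall>x. (deriv ^^ j) F field_differentiable at x) \<and>
    continuous_on UNIV ((deriv ^^ nat \<lfloor>r\<rfloor>) F) \<and>
    (frac r > 0 \<longrightarrow> Hoelder (frac r) ((deriv ^^ nat \<lfloor>r\<rfloor>) F))"

lemma C_class_one_plus:
  assumes "0 < \<tau>" "\<tau> < 1"
  shows "C_class (1 + \<tau>) F \<longleftrightarrow>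
    (\<forall>x. F field_differentiable at x) \<and> continuous_on UNIV (deriv F) \<and>
    (\<exists>C. \<forall>x y. \<bar>deriv F x - deriv F y\<bar> \<le> C * \<bar>x - y\<bar> powr \<tau>)"
proof -
  have "\<lfloor>1 + \<tau>\<rfloor> = 1" using assms by (simp add: floor_eq_iff)
  moreover from this have "frac (1 + \<tau>) = \<tau>" by (simp add: frac_def)
  ultimately show ?thesis using assms by (simp add: C_class_def Hoelder_def)
qed

text \<open>
  Regularity of circle maps is that of their lifts. Derivatives of lifts are periodic, so
  Hoelder continuity on the line and on the circle amount to the same.
\<close>

definition circle_C_class :: "real \<Rightarrow> (complex \<Rightarrow> complex) \<Rightarrow> bool"
  where "circle_C_class r f \<longleftrightarrow> (\<exists>F. is_lift F f \<and> C_class r F)"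

definition circle_diffeo :: "(complex \<Rightarrow> complex) \<Rightarrow> bool"
  where "circle_diffeo f \<longleftrightarrow>
    bij_betw f unit_circle unit_circle \<and>
    circle_C_class 1 f \<and> circle_C_class 1 (inv_into unit_circle f)"

definition orientation_preserving :: "(complex \<Rightarrow> complex) \<Rightarrow> bool"
  where "orientation_preserving f \<longleftrightarrow> (\<exists>F. is_lift F f \<and> strict_mono F)"

section \<open>Free and minimal actions\<close>

definition Z_power :: "nat \<Rightarrow> (nat \<Rightarrow> int) monoid"
  where "Z_power d = product_group {..<d} (\<lambda>_. integer_group)"

definition free_action :: "('g, 'm) monoid_scheme \<Rightarrow> 'x set \<Rightarrow> ('g \<Rightarrow> 'x \<Rightarrow> 'x) \<Rightarrow> bool"
  where "free_action G E \<phi> \<longleftrightarrow>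
    (\<forall>g \<in> carrier G. g \<noteq> \<one>\<^bsub>G\<^esub> \<longrightarrow> \<not> (\<exists>x \<in> E. \<phi> g x = x))"

definition minimal_action ::
    "('g, 'm) monoid_scheme \<Rightarrow> 'x::topological_space set \<Rightarrow> ('g \<Rightarrow> 'x \<Rightarrow> 'x) \<Rightarrow> bool"
  where "minimal_action G E \<phi> \<longleftrightarrow> (\<forall>x \<in> E. E \<subseteq> closure (orbit G \<phi> x))"

end

theory Submission
  imports Defs "HOL-Library.Sublist"
begin

text \<open>
  The proof follows Deroin, Kleptsyn and Navas, with their random walk replaced by an averaging
  argument. Suppose that some orbit is not dense. Its closure contains a minimal closed invariant
  set, which is not the whole circle. Let \<open>[a, b]\<close> be the closure of a gap of that set. Since the
  action is free, an element that maps a gap to itself fixes its endpoints and is trivial; therefore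
  the images \<open>I\<^sub>g\<close> of the gap are pairwise disjoint and the sum of their lengths is at most 1. On
  the other hand \<open>a\<close> is a recurrent point of the minimal set. If a neighbourhood of \<open>[a, b]\<close> were
  contracted to points by infinitely many group elements, then some nontrivial element would map
  this neighbourhood into itself and would have a fixed point. Both facts form
  \<open>nonminimal_wandering_interval\<close>, where the group is arbitrary.

  The contraction is produced as in Denjoy's theorem. Consider a path in the cone \<open>\<nat>\<^sup>d\<close>, that is, a
  product of generators to which one letter after the other is added. If the sum of the
  \<open>\<tau>\<close>-th powers of the lengths of \<open>I\<^sub>g\<close> over the points \<open>g\<close> of the path is at most \<open>C\<close>, then the
  Hoelder condition on the logarithmic derivatives of the generators bounds the distortion, and a
  neighbourhood of \<open>[a, b]\<close> that depends on the path only through \<open>C\<close> is mapped by the end point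
  \<open>g\<close> to an interval at most twice as long as \<open>I\<^sub>g\<close> (\<open>word_map_enlarged_interval_le\<close>). As the lengths
  are summable, these images shrink when the end points of the paths run to infinity. So it
  suffices to find paths of every length with one common \<open>C\<close> (\<open>words_with_bounded_cost\<close>).

  Such paths exist on average. The random path of the Polya urn is uniformly distributed on each
  level \<open>{g. g\<^sub>1 + \<dots> + g\<^sub>d = n}\<close>, which has about \<open>n\<^sup>d\<^sup>-\<^sup>1\<close> elements; by Young's inequality its
  expected cost is at most the sum of the lengths of all \<open>I\<^sub>g\<close> plus the series of
  \<open>n powr (- ((d - 1) * \<tau> / (1 - \<tau>)))\<close> times a constant. The series converges exactly if
  \<open>\<tau> > 1/d\<close>, and the regularity assumption provides such an exponent.
\<close>

section \<open>Cheap paths in the cone of nonnegative vectors\<close>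

text \<open>
  A level of the cone \<open>\<nat>\<^sup>d\<close>. The entries from \<open>d\<close> on are 0, so that levels are finite and
  \<open>count_list\<close> of a word in the letters below \<open>d\<close> is itself such a vector.
\<close>

definition compositions :: "nat \<Rightarrow> nat \<Rightarrow> (nat \<Rightarrow> nat) set"
  where "compositions d n = {v. (\<forall>i\<ge>d. v i = 0) \<and> (\<Sum>i<d. v i) = n}"

lemma finite_compositions: "finite (compositions d n)"
proof (rule finite_subset)
  show "compositions d n \<subseteq> {v. \<forall>i. (i \<in> {..<d} \<longrightarrow> v i \<in> {..n}) \<and> (i \<notin> {..<d} \<longrightarrow> v i = 0)}"
  proof
    fix v assume "v \<in> compositions d n"
    then have v: "\<forall>i\<ge>d. v i = 0" "(\<Sum>i<d. v i) = n"
      by (auto simp: compositions_def)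
    have "v i \<le> n" if "i < d" for i
      using member_le_sum[of i "{..<d}" v] that v(2) by simp
    with v show "v \<in> {v. \<forall>i. (i \<in> {..<d} \<longrightarrow> v i \<in> {..n}) \<and> (i \<notin> {..<d} \<longrightarrow> v i = 0)}"
      by auto
  qed
  show "finite {v. \<forall>i. (i \<in> {..<d} \<longrightarrow> v i \<in> {..n}) \<and> (i \<notin> {..<d} \<longrightarrow> v i = (0::nat))}"
    by (rule finite_set_of_finite_funs) auto
qed

lemma compositions_0: "compositions d 0 = {\<lambda>_. 0}"
proof -
  have "v = (\<lambda>_. 0)" if "v \<in> compositions d 0" for v
  proof
    fix i show "v i = 0"
      using that by (cases "i < d") (auto simp: compositions_def)
  qed
  moreover have "(\<lambda>_. 0) \<in> compositions d 0"
    by (simp add: compositions_def)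
  ultimately show ?thesis by blast
qed

lemma sum_fun_upd_Suc:
  assumes "i < (d::nat)"
  shows "(\<Sum>j<d. (v(i := Suc (v i))) j) = Suc (\<Sum>j<d. v j)"
proof -
  have "(\<Sum>j<d. (v(i := Suc (v i))) j) = Suc (v i) + (\<Sum>j\<in>{..<d} - {i}. (v(i := Suc (v i))) j)"
    using assms by (subst sum.remove[of _ i]) auto
  also have "(\<Sum>j\<in>{..<d} - {i}. (v(i := Suc (v i))) j) = (\<Sum>j\<in>{..<d} - {i}. v j)"
    by (rule sum.cong) auto
  also have "Suc (v i) + \<dots> = Suc (\<Sum>j<d. v j)"
    using assms by (subst (2) sum.remove[of _ i]) auto
  finally show ?thesis .
qed

lemma compositions_incr:
  assumes "u \<in> compositions d n" "i < d"
  shows "u(i := Suc (u i)) \<in> compositions d (Suc n)"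
  using assms sum_fun_upd_Suc[of i d u] by (auto simp: compositions_def)

lemma compositions_decr:
  assumes "v \<in> compositions d (Suc n)" "v i > 0"
  shows "v(i := v i - 1) \<in> compositions d n"
proof -
  have "i < d"
    using assms by (metis (mono_tags, lifting) compositions_def mem_Collect_eq not_le less_numeral_extra(3))
  then show ?thesis
    using assms sum_fun_upd_Suc[of i d "v(i := v i - 1)"] by (auto simp: compositions_def)
qed

text \<open>
  This is the Polya urn: the transition from \<open>u\<close> to \<open>u\<close> plus the \<open>i\<close>-th unit vector with probability
  \<open>(u i + 1) / (n + d)\<close> carries the uniform distribution of level \<open>n\<close> to the uniform distribution of
  level \<open>n + 1\<close>. Read backwards, a vector \<open>v\<close> of level \<open>n + 1\<close> came through coordinate \<open>i\<close> with
  probability \<open>v i / (n + 1)\<close>; the identity exchanges the two descriptions.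
\<close>

lemma sum_compositions_Suc:
  fixes h :: "(nat \<Rightarrow> nat) \<Rightarrow> real"
  shows "(\<Sum>v\<in>compositions d (Suc n). \<Sum>i<d. real (v i) * h (v(i := v i - 1)))
       = real (n + d) * (\<Sum>u\<in>compositions d n. h u)"
proof -
  have step: "(\<Sum>v\<in>compositions d (Suc n). real (v i) * h (v(i := v i - 1)))
            = (\<Sum>u\<in>compositions d n. real (Suc (u i)) * h u)" if "i < d" for i
  proof -
    have "(\<Sum>v\<in>compositions d (Suc n). real (v i) * h (v(i := v i - 1)))
        = (\<Sum>v\<in>{v \<in> compositions d (Suc n). v i > 0}. real (v i) * h (v(i := v i - 1)))"
      by (rule sum.mono_neutral_right) (auto simp: finite_compositions)
    also have "\<dots> = (\<Sum>u\<in>compositions d n. real (Suc (u i)) * h u)"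
      by (rule sum.reindex_bij_witness
            [of _ "\<lambda>u. u(i := Suc (u i))" "\<lambda>v. v(i := v i - 1)"])
         (use that compositions_decr compositions_incr in \<open>auto simp del: of_nat_Suc\<close>)
    finally show ?thesis .
  qed
  have "(\<Sum>v\<in>compositions d (Suc n). \<Sum>i<d. real (v i) * h (v(i := v i - 1)))
      = (\<Sum>i<d. \<Sum>u\<in>compositions d n. real (Suc (u i)) * h u)"
    by (subst sum.swap, rule sum.cong[OF refl], rule step) simp
  also have "\<dots> = (\<Sum>u\<in>compositions d n. (\<Sum>i<d. real (Suc (u i))) * h u)"
    by (subst sum.swap) (simp add: sum_distrib_right)
  also have "\<dots> = (\<Sum>u\<in>compositions d n. real (n + d) * h u)"
  proof (rule sum.cong[OF refl])
    fix u assume "u \<in> compositions d n"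
    then have "(\<Sum>i<d. Suc (u i)) = n + d"
      by (simp add: compositions_def sum_Suc)
    then show "(\<Sum>i<d. real (Suc (u i))) * h u = real (n + d) * h u"
      by (metis of_nat_sum)
  qed
  finally show ?thesis
    by (simp add: sum_distrib_left)
qed

lemma card_compositions_Suc:
  "real (Suc n) * card (compositions d (Suc n)) = real (n + d) * card (compositions d n)"
proof -
  have "(\<Sum>v\<in>compositions d (Suc n). \<Sum>i<d. real (v i)) = real (Suc n) * card (compositions d (Suc n))"
  proof -
    have "(\<Sum>i<d. real (v i)) = real (Suc n)" if "v \<in> compositions d (Suc n)" for v
      using that by (metis (mono_tags, lifting) compositions_def mem_Collect_eq of_nat_sum)
    then show ?thesis by (simp add: mult.commute)
  qed
  with sum_compositions_Suc[where h = "\<lambda>_. 1"] show ?thesis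
    by simp
qed

lemma card_compositions: "card (compositions (Suc k) n) = (n + k) choose k"
proof (induction n)
  case 0
  then show ?case by (simp add: compositions_0)
next
  case (Suc n)
  have "Suc n * card (compositions (Suc k) (Suc n)) = (n + Suc k) * card (compositions (Suc k) n)"
    using card_compositions_Suc[of n "Suc k"] by (metis of_nat_eq_iff of_nat_mult)
  also have "\<dots> = Suc n * ((Suc n + k) choose k)"
    using binomial_absorb_comp[of "Suc n + k" k] Suc.IH by simp
  finally show ?case by (metis mult_left_cancel nat.distinct(1))
qed

lemma card_compositions_ge:
  assumes "k > 0"
  shows "real (card (compositions (Suc k) n)) \<ge> (real (Suc n) / real (Suc k)) ^ k"
proof -
  have "real (Suc n) / real (Suc k) \<le> real (n + k) / real k"
    using assms by (simp add: field_simps)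
  then have "(real (Suc n) / real (Suc k)) ^ k \<le> (real (n + k) / real k) ^ k"
    by (intro power_mono) auto
  also have "\<dots> \<le> real ((n + k) choose k)"
    by (rule binomial_ge_n_over_k_pow_k) simp
  finally show ?thesis by (simp add: card_compositions)
qed

lemma card_compositions_pos: "d > 0 \<Longrightarrow> card (compositions d n) > 0"
  by (cases d) (simp_all add: card_compositions)

lemma exists_le_weighted_average:
  fixes p c :: "'a \<Rightarrow> real"
  assumes "finite A" "\<And>i. i \<in> A \<Longrightarrow> p i \<ge> 0" "(\<Sum>i\<in>A. p i) > 0"
  shows "\<exists>i\<in>A. p i > 0 \<and> (\<Sum>i\<in>A. p i) * c i \<le> (\<Sum>i\<in>A. p i * c i)"
proof (rule ccontr)
  assume "\<not> ?thesis"
  then have neg: "(\<Sum>i\<in>A. p i * c i) < (\<Sum>i\<in>A. p i) * c i" if "i \<in> A" "p i > 0" for i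
    using that by auto
  define m where "m = (\<Sum>i\<in>A. p i * c i) / (\<Sum>i\<in>A. p i)"
  have lt: "m < c i" if "i \<in> A" "p i > 0" for i
    using neg[OF that] assms(3) by (simp add: m_def field_simps)
  obtain j where j: "j \<in> A" "p j > 0"
    using assms(3) by (metis linorder_not_le sum_nonpos)
  have "(\<Sum>i\<in>A. p i * m) < (\<Sum>i\<in>A. p i * c i)"
  proof (rule sum_strict_mono_ex1[OF assms(1)])
    show "\<forall>i\<in>A. p i * m \<le> p i * c i"
      using assms(2) lt by (metis less_eq_real_def mult_left_mono mult_zero_left)
    show "\<exists>i\<in>A. p i * m < p i * c i"
      using j lt by (meson mult_strict_left_mono)
  qed
  also have "\<dots> = (\<Sum>i\<in>A. p i) * m"
    using assms(3) by (simp add: m_def)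
  finally show False
    by (simp add: sum_distrib_right)
qed

text \<open>
  A word is a path in \<open>\<nat>\<^sup>d\<close> starting at the origin: the most recent step is the head, so the
  points visited are the letter counts of the suffixes.
\<close>

definition word_cost :: "((nat \<Rightarrow> nat) \<Rightarrow> real) \<Rightarrow> nat list \<Rightarrow> real"
  where "word_cost w s = (\<Sum>t\<leftarrow>suffixes s. w (count_list t))"

lemma word_cost_Nil: "word_cost w [] = w (\<lambda>_. 0)"
  unfolding word_cost_def by (simp add: count_list.simps(1)[abs_def])

lemma word_cost_Cons: "word_cost w (i # s) = w (count_list (i # s)) + word_cost w s"
  by (simp add: word_cost_def)

text \<open>
  A random path of the Polya urn is uniformly distributed on every level, so its expected cost is
  the sum of the level averages of \<open>w\<close>. The induction derandomizes this: among the possible last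
  steps into \<open>v\<close> one has at most the average cost, with the backward probabilities \<open>v i / (n + 1)\<close>
  as weights, and the urn identity shows that the level average of the chosen costs does not exceed
  the expected cost.
\<close>

lemma polya_words:
  assumes "d > 0"
  shows "\<exists>p. (\<forall>v\<in>compositions d n. set (p v) \<subseteq> {..<d} \<and> length (p v) = n \<and> count_list (p v) = v) \<and>
           (\<Sum>v\<in>compositions d n. word_cost w (p v))
             \<le> card (compositions d n) * (\<Sum>k\<le>n. (\<Sum>u\<in>compositions d k. w u) / card (compositions d k))"
proof (induction n)
  case 0
  show ?case
    by (rule exI[of _ "\<lambda>_. []"]) (auto simp: compositions_0 word_cost_Nil)
next
  case (Suc n)
  then obtain p where
    p: "\<And>v. v \<in> compositions d n \<Longrightarrow> set (p v) \<subseteq> {..<d} \<and> length (p v) = n \<and> count_list (p v) = v"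
    and cost: "(\<Sum>v\<in>compositions d n. word_cost w (p v))
             \<le> card (compositions d n) * (\<Sum>k\<le>n. (\<Sum>u\<in>compositions d k. w u) / card (compositions d k))"
    by blast
  define c where "c v = word_cost w (p v)" for v
  have "\<exists>i<d. v i > 0 \<and> real (Suc n) * c (v(i := v i - 1)) \<le> (\<Sum>i<d. real (v i) * c (v(i := v i - 1)))"
    if "v \<in> compositions d (Suc n)" for v
  proof -
    have "(\<Sum>i<d. real (v i)) = real (Suc n)"
      using that by (metis (mono_tags, lifting) compositions_def mem_Collect_eq of_nat_sum)
    with exists_le_weighted_average[of "{..<d}" "\<lambda>i. real (v i)" "\<lambda>i. c (v(i := v i - 1))"]
    show ?thesis by auto
  qed
  then have "\<forall>v\<in>compositions d (Suc n). \<exists>i. i < d \<and> v i > 0 \<and>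
      real (Suc n) * c (v(i := v i - 1)) \<le> (\<Sum>j<d. real (v j) * c (v(j := v j - 1)))"
    by blast
  from bchoice[OF this] obtain i where i: "\<And>v. v \<in> compositions d (Suc n) \<Longrightarrow> i v < d \<and> v (i v) > 0 \<and>
      real (Suc n) * c (v(i v := v (i v) - 1)) \<le> (\<Sum>j<d. real (v j) * c (v(j := v j - 1)))"
    by blast
  define q where "q v = i v # p (v(i v := v (i v) - 1))" for v
  have q: "set (q v) \<subseteq> {..<d} \<and> length (q v) = Suc n \<and> count_list (q v) = v"
    if "v \<in> compositions d (Suc n)" for v
    using i[OF that] p[OF compositions_decr[OF that, of "i v"]] by (auto simp: q_def fun_eq_iff)
  have "real (Suc n) * (\<Sum>v\<in>compositions d (Suc n). word_cost w (q v))
      = real (Suc n) * (\<Sum>v\<in>compositions d (Suc n). w v)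
        + (\<Sum>v\<in>compositions d (Suc n). real (Suc n) * c (v(i v := v (i v) - 1)))"
  proof -
    have "word_cost w (q v) = w v + c (v(i v := v (i v) - 1))" if "v \<in> compositions d (Suc n)" for v
      using q[OF that] by (simp add: q_def c_def word_cost_Cons)
    then show ?thesis
      by (simp add: sum.distrib sum_distrib_left distrib_left)
  qed
  also have "\<dots> \<le> real (Suc n) * (\<Sum>v\<in>compositions d (Suc n). w v)
        + (\<Sum>v\<in>compositions d (Suc n). \<Sum>j<d. real (v j) * c (v(j := v j - 1)))"
    using i by (intro add_left_mono sum_mono) blast
  also have "\<dots> = real (Suc n) * (\<Sum>v\<in>compositions d (Suc n). w v) + real (n + d) * (\<Sum>v\<in>compositions d n. c v)"
    by (simp only: sum_compositions_Suc)
  also have "\<dots> \<le> real (Suc n) * (\<Sum>v\<in>compositions d (Suc n). w v) + real (n + d) *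
       (card (compositions d n) * (\<Sum>k\<le>n. (\<Sum>u\<in>compositions d k. w u) / card (compositions d k)))"
    using cost by (intro add_left_mono mult_left_mono) (auto simp: c_def)
  also have "\<dots> = real (Suc n) * (card (compositions d (Suc n)) *
       (\<Sum>k\<le>Suc n. (\<Sum>u\<in>compositions d k. w u) / card (compositions d k)))"
    using card_compositions_pos[OF assms, of "Suc n"]
    by (simp add: distrib_left mult.assoc[symmetric] card_compositions_Suc[symmetric] del: of_nat_Suc of_nat_add)
  finally have "(\<Sum>v\<in>compositions d (Suc n). word_cost w (q v)) \<le> card (compositions d (Suc n)) *
       (\<Sum>k\<le>Suc n. (\<Sum>u\<in>compositions d k. w u) / card (compositions d k))"
    by (rule mult_left_le_imp_le) simp
  with q show ?case by blast
qed

lemma cheap_word: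
  assumes "d > 0"
  obtains s where "set s \<subseteq> {..<d}" "length s = n"
    "word_cost w s \<le> (\<Sum>k\<le>n. (\<Sum>u\<in>compositions d k. w u) / card (compositions d k))"
proof -
  define m where "m = (\<Sum>k\<le>n. (\<Sum>u\<in>compositions d k. w u) / card (compositions d k))"
  obtain p where
    p: "\<And>v. v \<in> compositions d n \<Longrightarrow> set (p v) \<subseteq> {..<d} \<and> length (p v) = n \<and> count_list (p v) = v"
    and cost: "(\<Sum>v\<in>compositions d n. word_cost w (p v)) \<le> card (compositions d n) * m"
    using polya_words[OF assms, of n w] unfolding m_def by blast
  have "\<exists>v\<in>compositions d n. word_cost w (p v) \<le> m"
  proof (rule ccontr)
    assume "\<not> ?thesis"
    then have "(\<Sum>v\<in>compositions d n. m) < (\<Sum>v\<in>compositions d n. word_cost w (p v))"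
      using card_compositions_pos[OF assms, of n]
      by (intro sum_strict_mono finite_compositions) (auto simp: not_le card_gt_0_iff)
    with cost show False by simp
  qed
  with p show thesis
    by (auto simp: m_def intro: that)
qed

text \<open>
  Young's inequality with exponents \<open>\<tau>\<close> and \<open>1 - \<tau>\<close>; it separates the summable lengths from the
  sizes of the levels.
\<close>

lemma powr_divide_le:
  fixes x A \<tau> :: real
  assumes "x > 0" "A > 0" "0 < \<tau>" "\<tau> < 1"
  shows "x powr \<tau> / A \<le> x + A powr (- (1 / (1 - \<tau>)))"
proof -
  define y where "y = A powr (- (1 / (1 - \<tau>)))"
  have "y powr (1 - \<tau>) = A powr (- (1 / (1 - \<tau>)) * (1 - \<tau>))"
    unfolding y_def by (rule powr_powr)
  also have "\<dots> = inverse A"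
    using assms by (simp add: powr_minus)
  finally have "y powr (1 - \<tau>) = inverse A" .
  then have "x powr \<tau> / A = x powr \<tau> * y powr (1 - \<tau>)"
    by (simp add: divide_inverse)
  also have "\<dots> \<le> \<tau> * x + (1 - \<tau>) * y"
    using assms by (intro Youngs_inequality_0) (auto simp: y_def)
  also have "\<dots> \<le> 1 * x + 1 * y"
    using assms by (intro add_mono mult_right_mono) (auto simp: y_def)
  finally show ?thesis by (simp add: y_def)
qed

text \<open>
  Level \<open>n\<close> has about \<open>n\<^sup>d\<^sup>-\<^sup>1\<close> elements, and \<open>(d - 1) * \<tau> / (1 - \<tau>) > 1\<close> is the same as
  \<open>d * \<tau> > 1\<close>. This is the place where the threshold \<open>1/d\<close> for the regularity comes from.
\<close>

lemma summable_card_compositions_powr: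
  assumes "d \<ge> 2" "1 / real d < \<tau>" "\<tau> < 1"
  shows "summable (\<lambda>n. real (card (compositions d n)) powr (- (\<tau> / (1 - \<tau>))))"
proof -
  obtain k where k: "d = Suc k" "k > 0"
    using assms(1) by (cases d) auto
  have \<tau>: "\<tau> > 0" using assms(2) by (smt (verit) divide_nonneg_nonneg of_nat_0_le_iff)
  define \<alpha> where "\<alpha> = real k * (\<tau> / (1 - \<tau>))"
  have "real d * \<tau> > 1"
    using assms(1,2) by (simp add: field_simps)
  then have "\<alpha> > 1"
    using assms(3) by (simp add: \<alpha>_def k field_simps)
  then have "summable (\<lambda>n. real (Suc n) powr (- \<alpha>))"
    by (subst summable_Suc_iff) (simp add: summable_real_powr_iff)
  then have "summable (\<lambda>n. real (Suc k) powr \<alpha> * real (Suc n) powr (- \<alpha>))"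
    by (rule summable_mult)
  then show ?thesis
  proof (rule summable_comparison_test'[where N = 0])
    fix n :: nat
    have "real (card (compositions d n)) powr (- (\<tau> / (1 - \<tau>)))
        \<le> ((real (Suc n) / real (Suc k)) ^ k) powr (- (\<tau> / (1 - \<tau>)))"
      using card_compositions_ge[OF k(2), of n] \<tau> assms(3) k by (intro powr_mono2') auto
    also have "\<dots> = (real (Suc n) / real (Suc k)) powr (- \<alpha>)"
      by (simp add: powr_realpow[symmetric] powr_powr \<alpha>_def)
    also have "\<dots> = real (Suc k) powr \<alpha> * real (Suc n) powr (- \<alpha>)"
      by (simp add: powr_divide powr_minus field_simps)
    finally show "norm (real (card (compositions d n)) powr (- (\<tau> / (1 - \<tau>))))
        \<le> real (Suc k) powr \<alpha> * real (Suc n) powr (- \<alpha>)"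
      by simp
  qed
qed

proposition words_with_bounded_cost:
  fixes l :: "(nat \<Rightarrow> nat) \<Rightarrow> real"
  assumes d: "d \<ge> 2" and \<tau>: "1 / real d < \<tau>" "\<tau> < 1"
    and pos: "\<And>v. l v > 0"
    and sum1: "\<And>S. finite S \<Longrightarrow> S \<subseteq> {v. \<forall>i\<ge>d. v i = 0} \<Longrightarrow> sum l S \<le> 1"
  obtains C where "\<And>n. \<exists>s. set s \<subseteq> {..<d} \<and> length s = n \<and> word_cost (\<lambda>v. l v powr \<tau>) s \<le> C"
proof
  define A where "A n = real (card (compositions d n))" for n
  define \<beta> where "\<beta> = \<tau> / (1 - \<tau>)"
  have \<tau>0: "\<tau> > 0" using \<tau>(1) by (smt (verit) divide_nonneg_nonneg of_nat_0_le_iff)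
  have A: "A n > 0" for n
    using card_compositions_pos[of d n] d by (simp add: A_def)
  have sm: "summable (\<lambda>n. A n powr (- \<beta>))"
    using summable_card_compositions_powr[OF d \<tau>] by (simp add: A_def \<beta>_def)
  fix n
  obtain s where s: "set s \<subseteq> {..<d}" "length s = n"
    "word_cost (\<lambda>v. l v powr \<tau>) s \<le> (\<Sum>k\<le>n. (\<Sum>u\<in>compositions d k. l u powr \<tau>) / A k)"
    using d unfolding A_def by (auto intro: cheap_word[of d n "\<lambda>v. l v powr \<tau>"])
  have "(\<Sum>u\<in>compositions d k. l u powr \<tau>) / A k \<le> sum l (compositions d k) + A k powr (- \<beta>)" for k
  proof -
    have "(\<Sum>u\<in>compositions d k. l u powr \<tau>) / A k = (\<Sum>u\<in>compositions d k. l u powr \<tau> / A k)"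
      by (rule sum_divide_distrib)
    also have "\<dots> \<le> (\<Sum>u\<in>compositions d k. l u + A k powr (- (1 / (1 - \<tau>))))"
      using pos A \<tau>0 \<tau>(2) by (intro sum_mono powr_divide_le) auto
    also have "\<dots> = sum l (compositions d k) + A k * A k powr (- (1 / (1 - \<tau>)))"
      by (simp add: sum.distrib A_def)
    also have "A k * A k powr (- (1 / (1 - \<tau>))) = A k powr (1 + (- (1 / (1 - \<tau>))))"
      using A[of k] by (simp only: powr_add) simp
    also have "1 + (- (1 / (1 - \<tau>))) = - \<beta>"
      using \<tau>(2) by (simp add: \<beta>_def field_simps)
    finally show ?thesis .
  qed
  then have "(\<Sum>k\<le>n. (\<Sum>u\<in>compositions d k. l u powr \<tau>) / A k)
      \<le> (\<Sum>k\<le>n. sum l (compositions d k)) + (\<Sum>k\<le>n. A k powr (- \<beta>))"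
    unfolding sum.distrib[symmetric] by (intro sum_mono)
  also have "(\<Sum>k\<le>n. sum l (compositions d k)) = sum l (\<Union>k\<le>n. compositions d k)"
    by (rule sum.UNION_disjoint[symmetric]) (auto simp: finite_compositions, auto simp: compositions_def)
  also have "\<dots> \<le> 1"
    by (rule sum1) (auto simp: finite_compositions, auto simp: compositions_def)
  also have "(\<Sum>k\<le>n. A k powr (- \<beta>)) \<le> suminf (\<lambda>k. A k powr (- \<beta>))"
    by (rule sum_le_suminf[OF sm]) auto
  finally show "\<exists>s. set s \<subseteq> {..<d} \<and> length s = n \<and>
      word_cost (\<lambda>v. l v powr \<tau>) s \<le> 1 + suminf (\<lambda>k. A k powr (- \<beta>))"
    using s by (intro exI[of _ s]) auto
qed

section \<open>Distortion along words\<close>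

text \<open>
  As for paths, the head of the word is the generator that is applied last.
\<close>

definition word_map :: "(nat \<Rightarrow> real \<Rightarrow> real) \<Rightarrow> nat list \<Rightarrow> real \<Rightarrow> real"
  where "word_map F s = foldr (\<lambda>i f. F i \<circ> f) s id"

lemma word_map_simps [simp]: "word_map F [] x = x" "word_map F (i # s) x = F i (word_map F s x)"
  by (simp_all add: word_map_def)

text \<open>
  The distortion argument of Denjoy and Schwartz. If the image of the enlarged interval is at most
  twice as long as that of \<open>[a, b]\<close> for all shorter suffixes, then the logarithmic derivative of the
  word map varies on the enlarged interval by at most \<open>\<kappa>\<close> times the sum of the \<open>\<tau>\<close>-th powers of
  the doubled lengths, hence by at most \<open>\<kappa> * 2 powr \<tau> * C\<close>. The margin \<open>\<delta>\<close> is chosen such that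
  this bound on the distortion reproduces the factor 2 for the whole word. The margin depends on the
  word only through \<open>C\<close>.
\<close>

lemma word_map_enlarged_interval_le:
  fixes F F' :: "nat \<Rightarrow> real \<Rightarrow> real" and \<kappa> \<tau> a b :: real
  assumes ab: "a < b" and \<tau>: "\<tau> > 0" and \<kappa>: "\<kappa> \<ge> 0"
    and deriv: "\<And>i x. i < d \<Longrightarrow> (F i has_real_derivative F' i x) (at x)"
    and pos: "\<And>i x. i < d \<Longrightarrow> F' i x > 0"
    and hoelder: "\<And>i x y. i < d \<Longrightarrow> \<bar>ln (F' i x) - ln (F' i y)\<bar> \<le> \<kappa> * \<bar>x - y\<bar> powr \<tau>"
    and s: "set s \<subseteq> {..<d}"
    and cost: "(\<Sum>t\<leftarrow>suffixes s. (word_map F t b - word_map F t a) powr \<tau>) \<le> C"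
    and \<delta>: "\<delta> = (b - a) * exp (- (\<kappa> * 2 powr \<tau> * C)) / 2"
  shows "word_map F s (b + \<delta>) - word_map F s (a - \<delta>) \<le> 2 * (word_map F s b - word_map F s a)"
proof -
  let ?l = "\<lambda>t. word_map F t b - word_map F t a"
  have \<delta>0: "\<delta> > 0" using ab by (simp add: \<delta>)
  have mono: "strict_mono (word_map F t)" if "set t \<subseteq> {..<d}" for t
    using that
  proof (induction t)
    case (Cons i t)
    then have "i < d" by simp
    then have "F i x < F i y" if "x < y" for x y
      by (intro DERIV_pos_imp_increasing[OF that]) (use deriv pos in blast)
    with Cons show ?case by (simp add: strict_mono_def)
  qed (simp add: strict_mono_def)
  define S where "S t = sum_list (map (\<lambda>t. ?l t powr \<tau>) (suffixes t))" for t
  have S_Cons: "S (i # t) = S t + ?l (i # t) powr \<tau>" for i t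
    by (simp add: S_def)
  have S_nonneg: "S t \<ge> 0" for t
    unfolding S_def by (rule sum_list_nonneg) auto
  \<comment> \<open>The derivative of a word map is a product over the proper suffixes only, hence the term
    that is subtracted from \<open>S t\<close>: a new letter adds the contribution of the word to which it is
    applied.\<close>
  have main: "\<exists>D. (\<forall>x. (word_map F t has_real_derivative D x) (at x) \<and> D x > 0) \<and>
       (\<forall>x\<in>{a-\<delta>..b+\<delta>}. \<forall>y\<in>{a-\<delta>..b+\<delta>}.
          \<bar>ln (D x) - ln (D y)\<bar> \<le> \<kappa> * 2 powr \<tau> * (S t - ?l t powr \<tau>)) \<and>
       word_map F t (b + \<delta>) - word_map F t (a - \<delta>) \<le> 2 * ?l t"
    if "set t \<subseteq> {..<d}" "S t \<le> C" for t
    using that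
  proof (induction t)
    case Nil
    have "C \<ge> 0" using Nil(2) S_nonneg[of "[]"] by linarith
    then have "exp (- (\<kappa> * 2 powr \<tau> * C)) \<le> 1" using \<kappa> by simp
    then have "(b - a) * exp (- (\<kappa> * 2 powr \<tau> * C)) \<le> (b - a) * 1"
      using ab by (intro mult_left_mono) auto
    then have "\<delta> \<le> (b - a) / 2" by (simp add: \<delta>)
    moreover have "(word_map F [] has_real_derivative 1) (at x)" for x
      by (simp add: word_map_def id_def)
    ultimately show ?case
      by (intro exI[of _ "\<lambda>_. 1"]) (auto simp: S_def)
  next
    case (Cons i t)
    have i: "i < d" and t: "set t \<subseteq> {..<d}" using Cons.prems by auto
    have "S t \<le> C" using Cons.prems(2) S_Cons[of i t] powr_ge_zero[of "?l (i # t)" \<tau>] by linarith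
    with Cons.IH[OF t] obtain D where
      D: "\<And>x. (word_map F t has_real_derivative D x) (at x)" "\<And>x. D x > 0"
      and dist: "\<And>x y. x \<in> {a-\<delta>..b+\<delta>} \<Longrightarrow> y \<in> {a-\<delta>..b+\<delta>} \<Longrightarrow>
          \<bar>ln (D x) - ln (D y)\<bar> \<le> \<kappa> * 2 powr \<tau> * (S t - ?l t powr \<tau>)"
      and len: "word_map F t (b + \<delta>) - word_map F t (a - \<delta>) \<le> 2 * ?l t"
      by blast
    define E where "E x = F' i (word_map F t x) * D x" for x
    have E: "(word_map F (i # t) has_real_derivative E x) (at x)" for x
    proof -
      have "((\<lambda>x. F i (word_map F t x)) has_real_derivative E x) (at x)"
        unfolding E_def by (rule DERIV_chain2[OF deriv[OF i] D(1)])
      then show ?thesis by (simp add: word_map_def o_def)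
    qed
    have Epos: "E x > 0" for x
      using D(2) pos[OF i] by (simp add: E_def)
    have lt: "?l t > 0"
      using mono[OF t] ab by (simp add: strict_mono_def)
    have distE: "\<bar>ln (E x) - ln (E y)\<bar> \<le> \<kappa> * 2 powr \<tau> * S t"
      if xy: "x \<in> {a-\<delta>..b+\<delta>}" "y \<in> {a-\<delta>..b+\<delta>}" for x y
    proof -
      have "word_map F t z \<in> {word_map F t (a - \<delta>)..word_map F t (b + \<delta>)}" if "z \<in> {a-\<delta>..b+\<delta>}" for z
        using strict_mono_less_eq[OF mono[OF t]] that by auto
      from this[OF xy(1)] this[OF xy(2)] have "\<bar>word_map F t x - word_map F t y\<bar> \<le> 2 * ?l t"
        using len by auto
      then have "\<bar>word_map F t x - word_map F t y\<bar> powr \<tau> \<le> (2 * ?l t) powr \<tau>"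
        using \<tau> by (intro powr_mono2) auto
      also have "\<dots> = 2 powr \<tau> * ?l t powr \<tau>"
        by (rule powr_mult)
      finally have "\<kappa> * \<bar>word_map F t x - word_map F t y\<bar> powr \<tau> \<le> \<kappa> * (2 powr \<tau> * ?l t powr \<tau>)"
        using \<kappa> by (intro mult_left_mono) auto
      with hoelder[OF i, of "word_map F t x" "word_map F t y"]
      have 1: "\<bar>ln (F' i (word_map F t x)) - ln (F' i (word_map F t y))\<bar> \<le> \<kappa> * 2 powr \<tau> * ?l t powr \<tau>"
        by (simp add: mult.assoc)
      have 2: "ln (E z) = ln (F' i (word_map F t z)) + ln (D z)" for z
        unfolding E_def by (intro ln_mult_pos pos[OF i] D(2))
      show ?thesis
        using 1 dist[OF xy] unfolding 2 by (simp add: algebra_simps)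
    qed
    have SC: "S t \<le> C" by fact
    have ratio: "E x \<le> exp (\<kappa> * 2 powr \<tau> * C) * E y"
      if "x \<in> {a-\<delta>..b+\<delta>}" "y \<in> {a-\<delta>..b+\<delta>}" for x y
    proof -
      have "\<kappa> * 2 powr \<tau> * S t \<le> \<kappa> * 2 powr \<tau> * C"
        using SC \<kappa> by (intro mult_left_mono) auto
      with distE[OF that] have "ln (E x) \<le> \<kappa> * 2 powr \<tau> * C + ln (E y)" by linarith
      then have "exp (ln (E x)) \<le> exp (\<kappa> * 2 powr \<tau> * C + ln (E y))" by simp
      then show ?thesis using Epos by (simp add: exp_add)
    qed
    \<comment> \<open>The derivatives at points of a margin and of \<open>[a, b]\<close> differ at most by the factor
      that \<open>\<delta>\<close> compensates, so each margin is mapped to at most half the length of the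
      image of \<open>[a, b]\<close>.\<close>
    let ?W = "word_map F (i # t)"
    obtain y where y: "a < y" "y < b" "?W b - ?W a = (b - a) * E y"
      using MVT2[OF ab, of ?W E] E by blast
    have short: "?W q - ?W p \<le> ?l (i # t) / 2"
      if pq: "p < q" "q - p = \<delta>" "{p..q} \<subseteq> {a-\<delta>..b+\<delta>}" for p q
    proof -
      obtain x where x: "p < x" "x < q" "?W q - ?W p = (q - p) * E x"
        using MVT2[OF pq(1), of ?W E] E by blast
      have "?W q - ?W p \<le> \<delta> * (exp (\<kappa> * 2 powr \<tau> * C) * E y)"
        unfolding x(3) pq(2) using \<delta>0 x pq(3) y by (intro mult_left_mono ratio) auto
      also have "\<dots> = (b - a) * E y / 2 * (exp (- (\<kappa> * 2 powr \<tau> * C)) * exp (\<kappa> * 2 powr \<tau> * C))"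
        by (simp add: \<delta>)
      also have "\<dots> = ?l (i # t) / 2"
        unfolding y(3) by (subst exp_add[symmetric]) simp
      finally show ?thesis .
    qed
    have "?W (b + \<delta>) - ?W (a - \<delta>) = (?W (b + \<delta>) - ?W b) + ?l (i # t) + (?W a - ?W (a - \<delta>))"
      by simp
    also have "\<dots> \<le> 2 * ?l (i # t)"
      using short[of b "b + \<delta>"] short[of "a - \<delta>" a] \<delta>0 ab by simp
    finally have len': "?W (b + \<delta>) - ?W (a - \<delta>) \<le> 2 * ?l (i # t)" .
    show ?case
      by (intro exI[of _ E] conjI allI ballI E Epos len') (use distE in \<open>simp add: S_Cons\<close>)
  qed
  have "S s \<le> C" using cost by (simp add: S_def)
  from main[OF s this] show ?thesis by blast
qed

section \<open>Lifts of circle diffeomorphisms\<close>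

abbreviation circ :: "real \<Rightarrow> complex"
  where "circ t \<equiv> cis (2 * pi * t)"

lemma circ_eq_iff: "circ s = circ t \<longleftrightarrow> (\<exists>k::int. s = t + of_int k)"
proof -
  have "circ s = circ t \<longleftrightarrow> (\<exists>k::int. 2 * pi * s = 2 * pi * t + 2 * pi * of_int k)"
    using sin_cos_eq_iff[of "2 * pi * s" "2 * pi * t"] by (auto simp: complex_eq_iff)
  also have "\<dots> \<longleftrightarrow> (\<exists>k::int. 2 * pi * s = 2 * pi * (t + of_int k))"
    by (simp only: distrib_left)
  finally show ?thesis by simp
qed

lemma circ_add_int [simp]: "circ (t + of_int k) = circ t"
  by (subst circ_eq_iff) blast

lemma circ_surj:
  assumes "z \<in> unit_circle"
  obtains t where "z = circ t"
proof
  have "z \<noteq> 0" "norm z = 1" using assms by auto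
  then show "z = circ (Arg z / (2 * pi))"
    by (simp add: cis_Arg sgn_div_norm)
qed

lemma circ_in_circle [simp]: "circ t \<in> unit_circle"
  by simp

lemma continuous_Ints_constant:
  fixes h :: "real \<Rightarrow> real"
  assumes "continuous_on UNIV h" "\<And>x. h x \<in> \<int>"
  shows "\<exists>k::int. \<forall>x. h x = of_int k"
proof -
  have "h constant_on UNIV"
  proof (rule continuous_discrete_range_constant[OF connected_UNIV assms(1)])
    fix x :: real
    have "1 \<le> norm (h y - h x)" if "h y \<noteq> h x" for y
      using that assms(2)[of x] assms(2)[of y] Ints_nonzero_abs_ge1[of "h y - h x"] by simp
    then show "\<exists>e>0. \<forall>y. y \<in> UNIV \<and> h y \<noteq> h x \<longrightarrow> e \<le> norm (h y - h x)"
      by (intro exI[of _ 1]) auto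
  qed
  then obtain c where c: "\<And>x. h x = c" by (auto simp: constant_on_def)
  moreover from assms(2)[of 0] obtain k where "h 0 = of_int k" by (auto elim: Ints_cases)
  ultimately show ?thesis by metis
qed

lemma is_lift_unique:
  assumes "is_lift F f" "is_lift G f"
  obtains k :: int where "\<And>x. G x = F x + of_int k"
proof -
  have "\<exists>k::int. \<forall>x. G x - F x = of_int k"
  proof (rule continuous_Ints_constant)
    show "continuous_on UNIV (\<lambda>x. G x - F x)"
      using assms by (auto simp: is_lift_def intro: continuous_on_diff)
    fix x
    have "circ (G x) = circ (F x)"
      using assms by (metis is_lift_def)
    then show "G x - F x \<in> \<int>"
      by (auto simp: circ_eq_iff)
  qed
  then show thesis
    by (metis add.commute diff_add_cancel that)
qed

lemma is_lift_comp: "is_lift F f \<Longrightarrow> is_lift G g \<Longrightarrow> is_lift (F \<circ> G) (f \<circ> g)"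
  using continuous_on_compose2[of UNIV F UNIV G] by (auto simp: is_lift_def)

lemma is_lift_cong: "is_lift F f \<Longrightarrow> (\<And>z. z \<in> unit_circle \<Longrightarrow> f z = g z) \<Longrightarrow> is_lift F g"
  by (metis circ_in_circle is_lift_def)

lemma is_lift_id: "is_lift id id"
  by (simp add: is_lift_def)

lemma is_lift_translate: "is_lift F f \<Longrightarrow> is_lift (\<lambda>x. F (x + 1)) f"
proof -
  assume F: "is_lift F f"
  have "continuous_on UNIV (F \<circ> (\<lambda>x. x + 1))"
    using F continuous_on_subset[of UNIV F] by (intro continuous_on_compose continuous_intros) (auto simp: is_lift_def)
  moreover have "f (circ x) = circ (F (x + 1))" for x
    using F circ_add_int[of x 1] unfolding is_lift_def by (metis of_int_1)
  ultimately show ?thesis by (simp add: is_lift_def o_def)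
qed

text \<open>
  The degree is a positive integer because the lift increases, and it divides the degree 1 of the
  identity because the inverse has a lift as well.
\<close>

lemma lift_degree_one:
  assumes F: "is_lift F f" "strict_mono F" and G: "is_lift G g"
    and inv: "\<And>z. z \<in> unit_circle \<Longrightarrow> g (f z) = z"
  shows "F (x + 1) = F x + 1"
proof -
  obtain m :: int where m: "\<And>x. F (x + 1) = F x + of_int m"
    using is_lift_unique[OF F(1) is_lift_translate[OF F(1)]] by blast
  obtain m' :: int where m': "\<And>x. G (x + 1) = G x + of_int m'"
    using is_lift_unique[OF G is_lift_translate[OF G]] by blast
  have nat_shift: "G (x + real n) = G x + real n * of_int m'" for x n
  proof (induction n)
    case (Suc n)
    then show ?case
      using m'[of "x + real n"] by (simp add: algebra_simps)
  qed simp
  have "F 0 < F 1" using F(2) by (simp add: strict_mono_def)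
  then have "m > 0" using m[of 0] by simp
  have "is_lift (G \<circ> F) id"
    by (rule is_lift_cong[OF is_lift_comp[OF G F(1)]]) (simp add: inv)
  then obtain c :: int where c: "\<And>x. G (F x) = x + of_int c"
    using is_lift_unique[OF is_lift_id, of "G \<circ> F"] by (metis comp_apply id_apply)
  have "x + 1 + of_int c = x + of_int c + of_int (m * m')"
    using c[of x] c[of "x + 1"] m[of x] nat_shift[of "F x" "nat m"] \<open>m > 0\<close> by simp
  then have "of_int (m * m') = (1::real)" by simp
  then have "m * m' = 1" by linarith
  with \<open>m > 0\<close> have "m = 1" using pos_zmult_eq_1_iff by blast
  with m show ?thesis by simp
qed

lemma periodic_continuous_bounds:
  fixes h :: "real \<Rightarrow> real"
  assumes "continuous_on UNIV h" "\<And>x. h (x + 1) = h x"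
  obtains u v where "\<And>x. h u \<le> h x" "\<And>x. h x \<le> h v"
proof -
  have int: "h (x + of_int k) = h x" for x k
  proof (induction k rule: int_induct[where k = 0])
    case (step1 i)
    then show ?case using assms(2)[of "x + of_int i"] by (simp add: add.assoc)
  next
    case (step2 i)
    then show ?case using assms(2)[of "x + of_int i - 1"] by (simp add: algebra_simps)
  qed simp
  have frac: "h x = h (frac x)" for x
    using int[of "frac x" "\<lfloor>x\<rfloor>"] by (simp add: frac_def)
  have c: "continuous_on {0..1} h"
    using assms(1) by (rule continuous_on_subset) auto
  have mem: "frac x \<in> {0..1}" for x :: real
    using frac_lt_1[of x] by (simp add: less_imp_le)
  obtain u where "\<forall>y\<in>{0..1}. h u \<le> h y"
    using continuous_attains_inf[OF _ _ c] by auto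
  moreover obtain v where "\<forall>y\<in>{0..1}. h y \<le> h v"
    using continuous_attains_sup[OF _ _ c] by auto
  ultimately show thesis
    using that frac mem by metis
qed

lemma deriv_periodic:
  fixes F :: "real \<Rightarrow> real"
  assumes "\<And>x. F (x + 1) = F x + c"
  shows "deriv F (x + 1) = deriv F x"
proof -
  have "DERIV F (x + 1) :> D \<longleftrightarrow> DERIV F x :> D" for D
  proof -
    have "DERIV F (x + 1) :> D \<longleftrightarrow> DERIV (\<lambda>x. F (x + 1)) x :> D"
      by (rule DERIV_shift)
    also have "(\<lambda>x. F (x + 1)) = (\<lambda>x. F x + c)"
      using assms by auto
    also have "DERIV (\<lambda>x. F x + c) x :> D \<longleftrightarrow> DERIV F x :> D"
      using DERIV_diff[OF _ DERIV_const[of c], of "\<lambda>x. F x + c" D x UNIV]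
      by (auto intro!: derivative_eq_intros)
    finally show ?thesis .
  qed
  then show ?thesis by (simp add: deriv_def)
qed

lemma C_class_imp_C1:
  assumes "C_class r F" "r \<ge> 1"
  shows "(F has_real_derivative deriv F x) (at x)" and "continuous_on UNIV (deriv F)"
proof -
  define n where "n = nat \<lfloor>r\<rfloor>"
  have n: "n \<ge> 1" using assms(2) by (simp add: n_def le_nat_iff le_floor_iff)
  have diff: "\<And>j x. j < n \<Longrightarrow> (deriv ^^ j) F field_differentiable at x"
    and cont: "continuous_on UNIV ((deriv ^^ n) F)"
    using assms(1) by (auto simp: C_class_def n_def)
  show "(F has_real_derivative deriv F x) (at x)"
    using diff[of 0 x] n by (simp add: DERIV_deriv_iff_field_differentiable)
  show "continuous_on UNIV (deriv F)"
  proof (cases "n = 1")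
    case True
    then show ?thesis using cont by simp
  next
    case False
    then have "deriv F field_differentiable at x" for x
      using diff[of 1 x] n by simp
    then show ?thesis
      by (meson continuous_at_imp_continuous_on field_differentiable_imp_continuous_at)
  qed
qed

text \<open>
  For \<open>\<sigma> \<ge> 1\<close> the derivative is Lipschitz, by periodicity of the second derivative. In both
  cases the exponent can only be lowered at distances up to 1; for larger distances the estimate
  holds because the derivative is periodic, hence bounded.
\<close>

lemma C_class_imp_deriv_hoelder:
  assumes C: "C_class (1 + \<sigma>) F" and \<tau>: "0 < \<tau>" "\<tau> < 1" "\<tau> \<le> \<sigma>"
    and per: "\<And>x. F (x + 1) = F x + 1"
  obtains L where "L \<ge> 0" "\<And>x y. \<bar>deriv F x - deriv F y\<bar> \<le> L * \<bar>x - y\<bar> powr \<tau>"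
proof -
  have cont: "continuous_on UNIV (deriv F)"
    using C_class_imp_C1(2)[OF C] \<tau> by simp
  have per': "deriv F (x + 1) = deriv F x" for x
    using per by (rule deriv_periodic)
  have "\<exists>L. \<forall>x y. \<bar>x - y\<bar> \<le> 1 \<longrightarrow> \<bar>deriv F x - deriv F y\<bar> \<le> L * \<bar>x - y\<bar> powr \<tau>"
  proof (cases "\<sigma> < 1")
    case True
    then obtain L where L: "\<And>x y. \<bar>deriv F x - deriv F y\<bar> \<le> L * \<bar>x - y\<bar> powr \<sigma>"
      using C C_class_one_plus[of \<sigma> F] \<tau> by auto
    have "\<bar>deriv F x - deriv F y\<bar> \<le> \<bar>L\<bar> * \<bar>x - y\<bar> powr \<tau>" if "\<bar>x - y\<bar> \<le> 1" for x y
    proof -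
      have "\<bar>deriv F x - deriv F y\<bar> \<le> \<bar>L\<bar> * \<bar>x - y\<bar> powr \<sigma>"
        using L[of x y] by (meson abs_ge_self mult_right_mono order_trans powr_ge_zero)
      also have "\<dots> \<le> \<bar>L\<bar> * \<bar>x - y\<bar> powr \<tau>"
        using that \<tau> by (intro mult_left_mono powr_mono') auto
      finally show ?thesis .
    qed
    then show ?thesis by blast
  next
    case False
    define n where "n = nat \<lfloor>1 + \<sigma>\<rfloor>"
    have n: "n \<ge> 2" using False by (simp add: n_def le_nat_iff le_floor_iff)
    have diff: "\<And>j x. j < n \<Longrightarrow> (deriv ^^ j) F field_differentiable at x"
      and contn: "continuous_on UNIV ((deriv ^^ n) F)"
      using C by (auto simp: C_class_def n_def)
    have d1: "(deriv F has_real_derivative deriv (deriv F) x) (at x)" for x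
      using diff[of 1 x] n by (simp add: DERIV_deriv_iff_field_differentiable)
    have "continuous_on UNIV (deriv (deriv F))"
    proof (cases "n = 2")
      case True
      then show ?thesis using contn by (simp add: numeral_2_eq_2)
    next
      case False
      then have "deriv (deriv F) field_differentiable at x" for x
        using diff[of 2 x] n by (simp add: numeral_2_eq_2)
      then show ?thesis
        by (meson continuous_at_imp_continuous_on field_differentiable_imp_continuous_at)
    qed
    moreover have "deriv (deriv F) (x + 1) = deriv (deriv F) x" for x
      by (rule deriv_periodic[where c = 0]) (simp add: per')
    ultimately obtain u v where uv: "\<And>x. deriv (deriv F) u \<le> deriv (deriv F) x" "\<And>x. deriv (deriv F) x \<le> deriv (deriv F) v"
      using periodic_continuous_bounds by blast
    define L where "L = \<bar>deriv (deriv F) u\<bar> + \<bar>deriv (deriv F) v\<bar>"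
    have L: "\<bar>deriv (deriv F) x\<bar> \<le> L" for x
      using uv[of x] by (simp add: L_def)
    have "\<bar>deriv F x - deriv F y\<bar> \<le> L * \<bar>x - y\<bar> powr \<tau>" if "\<bar>x - y\<bar> \<le> 1" for x y
    proof -
      have "\<bar>deriv F x - deriv F y\<bar> \<le> L * \<bar>x - y\<bar>"
        using field_differentiable_bound[of UNIV "deriv F" "deriv (deriv F)" L x y] d1 L by auto
      also have "\<dots> \<le> L * \<bar>x - y\<bar> powr \<tau>"
      proof (intro mult_left_mono)
        show "\<bar>x - y\<bar> \<le> \<bar>x - y\<bar> powr \<tau>"
          using powr_mono'[of \<tau> 1 "\<bar>x - y\<bar>"] that \<tau> by simp
      qed (simp add: L_def)
      finally show ?thesis .
    qed
    then show ?thesis by blast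
  qed
  then obtain L where L: "\<And>x y. \<bar>x - y\<bar> \<le> 1 \<Longrightarrow> \<bar>deriv F x - deriv F y\<bar> \<le> L * \<bar>x - y\<bar> powr \<tau>"
    by blast
  obtain u v where uv: "\<And>x. deriv F u \<le> deriv F x" "\<And>x. deriv F x \<le> deriv F v"
    using periodic_continuous_bounds[OF cont per'] by blast
  define M where "M = max \<bar>L\<bar> (deriv F v - deriv F u)"
  have "\<bar>deriv F x - deriv F y\<bar> \<le> M * \<bar>x - y\<bar> powr \<tau>" for x y
  proof (cases "\<bar>x - y\<bar> \<le> 1")
    case True
    have "L * \<bar>x - y\<bar> powr \<tau> \<le> M * \<bar>x - y\<bar> powr \<tau>"
      by (intro mult_right_mono) (auto simp: M_def)
    with L[OF True] show ?thesis by linarith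
  next
    case False
    have "\<bar>deriv F x - deriv F y\<bar> \<le> M * 1"
      using uv[of x] uv[of y] by (simp add: M_def)
    also have "\<dots> \<le> M * \<bar>x - y\<bar> powr \<tau>"
      using False \<tau> by (intro mult_left_mono ge_one_powr_ge_zero) (auto simp: M_def)
    finally show ?thesis .
  qed
  then show thesis
    by (rule that[rotated]) (auto simp: M_def)
qed

lemma abs_ln_diff_le:
  fixes u v c :: real
  assumes "c > 0" "c \<le> u" "c \<le> v"
  shows "\<bar>ln u - ln v\<bar> \<le> \<bar>u - v\<bar> / c"
proof -
  have *: "ln p - ln q \<le> \<bar>p - q\<bar> / c" if "c \<le> p" "c \<le> q" for p q
  proof -
    have "ln p - ln q \<le> (p - q) / q"
      using that assms(1) by (intro ln_diff_le) auto
    also have "\<dots> \<le> \<bar>p - q\<bar> / q"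
      using that assms(1) by (intro divide_right_mono) auto
    also have "\<dots> \<le> \<bar>p - q\<bar> / c"
      using that assms(1) by (intro divide_left_mono) auto
    finally show ?thesis .
  qed
  show ?thesis
    using *[of u v] *[of v u] assms by (simp add: abs_minus_commute abs_le_iff)
qed

text \<open>
  The derivative of the lift has no zero, as the inverse has a differentiable lift too. Being
  periodic it stays away from 0, so its logarithm inherits the Hoelder condition.
\<close>

proposition circle_diffeo_lift:
  assumes f: "circle_diffeo f" "orientation_preserving f" "circle_C_class (1 + \<sigma>) f"
    and \<tau>: "0 < \<tau>" "\<tau> < 1" "\<tau> \<le> \<sigma>"
  obtains F F' \<kappa> where "is_lift F f" "strict_mono F" "\<And>x. F (x + 1) = F x + 1"
    "\<And>x. (F has_real_derivative F' x) (at x)" "\<And>x. F' x > 0"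
    "\<kappa> \<ge> 0" "\<And>x y. \<bar>ln (F' x) - ln (F' y)\<bar> \<le> \<kappa> * \<bar>x - y\<bar> powr \<tau>"
proof -
  obtain F where F: "is_lift F f" "C_class (1 + \<sigma>) F"
    using f(3) by (auto simp: circle_C_class_def)
  obtain G where G: "is_lift G (inv_into unit_circle f)" "C_class 1 G"
    using f(1) by (auto simp: circle_diffeo_def circle_C_class_def)
  have inv: "inv_into unit_circle f (f z) = z" if "z \<in> unit_circle" for z
    using f(1) that by (metis circle_diffeo_def bij_betw_inv_into_left)
  obtain H where H: "is_lift H f" "strict_mono H"
    using f(2) by (auto simp: orientation_preserving_def)
  obtain k :: int where "\<And>x. F x = H x + of_int k"
    using is_lift_unique[OF H(1) F(1)] by blast
  with H(2) have mono: "strict_mono F" by (simp add: strict_mono_def)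
  have per: "F (x + 1) = F x + 1" for x
    by (rule lift_degree_one[OF F(1) mono G(1) inv])
  have dF: "(F has_real_derivative deriv F x) (at x)" for x
    using C_class_imp_C1(1)[OF F(2)] \<tau> by simp
  have cF: "continuous_on UNIV (deriv F)"
    using C_class_imp_C1(2)[OF F(2)] \<tau> by simp
  have dG: "(G has_real_derivative deriv G x) (at x)" for x
    by (rule C_class_imp_C1(1)[OF G(2)]) simp
  have "is_lift (G \<circ> F) id"
    by (rule is_lift_cong[OF is_lift_comp[OF G(1) F(1)]]) (simp add: inv)
  then obtain c :: int where c: "\<And>x. G (F x) = x + of_int c"
    using is_lift_unique[OF is_lift_id, of "G \<circ> F"] by (metis comp_apply id_apply)
  have pos: "deriv F x > 0" for x
  proof -
    have "((\<lambda>x. G (F x)) has_real_derivative deriv G (F x) * deriv F x) (at x)"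
      by (rule DERIV_chain2[OF dG dF])
    moreover have "((\<lambda>x. G (F x)) has_real_derivative 1) (at x)"
      unfolding c by (auto intro!: derivative_eq_intros)
    ultimately have "deriv G (F x) * deriv F x = 1"
      by (rule DERIV_unique)
    then have "deriv F x \<noteq> 0" by auto
    moreover have "deriv F x \<ge> 0"
      using mono_imp_mono_on[OF strict_mono_mono[OF mono], of UNIV] dF[of x]
      by (metis UNIV_I interior_UNIV mono_on_imp_deriv_nonneg)
    ultimately show ?thesis by simp
  qed
  obtain L where L: "L \<ge> 0" "\<And>x y. \<bar>deriv F x - deriv F y\<bar> \<le> L * \<bar>x - y\<bar> powr \<tau>"
    using C_class_imp_deriv_hoelder[OF F(2) \<tau> per] by blast
  have "\<exists>u. \<forall>x. deriv F u \<le> deriv F x"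
    by (rule periodic_continuous_bounds[OF cF deriv_periodic[of F 1, OF per]]) blast
  then obtain u where u: "\<And>x. deriv F u \<le> deriv F x" by blast
  have "\<bar>ln (deriv F x) - ln (deriv F y)\<bar> \<le> L / deriv F u * \<bar>x - y\<bar> powr \<tau>" for x y
  proof -
    have "\<bar>ln (deriv F x) - ln (deriv F y)\<bar> \<le> \<bar>deriv F x - deriv F y\<bar> / deriv F u"
      by (rule abs_ln_diff_le[OF pos u u])
    also have "\<dots> \<le> L * \<bar>x - y\<bar> powr \<tau> / deriv F u"
      using L(2)[of x y] pos[of u] by (intro divide_right_mono) auto
    finally show ?thesis by simp
  qed
  moreover have "L / deriv F u \<ge> 0"
    using L(1) pos[of u] by simp
  ultimately show thesis
    using that[OF F(1) mono per dF pos] by blast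
qed

section \<open>Wandering intervals of free actions that are not minimal\<close>

lemma sum_disjoint_intervals_le:
  fixes l r :: "'i \<Rightarrow> real"
  assumes "finite S" "c \<le> d"
    and "\<And>i. i \<in> S \<Longrightarrow> c \<le> l i \<and> l i \<le> r i \<and> r i \<le> d"
    and disj: "disjoint_family_on (\<lambda>i. {l i<..<r i}) S"
  shows "(\<Sum>i\<in>S. r i - l i) \<le> d - c"
proof -
  have "(\<Sum>i\<in>S. r i - l i) = (\<Sum>i\<in>S. measure lborel {l i<..<r i})"
    using assms(3) by (intro sum.cong) auto
  also have "\<dots> = measure lborel (\<Union>i\<in>S. {l i<..<r i})"
    using assms(1) disj assms(3) by (intro measure_finite_Union[symmetric]) auto
  also have "\<dots> \<le> measure lborel {c..d}"
  proof (rule measure_mono_fmeasurable)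
    show "(\<Union>i\<in>S. {l i<..<r i}) \<subseteq> {c..d}"
      using assms(3) by force
    show "(\<Union>i\<in>S. {l i<..<r i}) \<in> sets lborel"
      using assms(1) by (intro sets.finite_UN) auto
    show "{c..d} \<in> fmeasurable lborel"
      using assms(2) by (intro fmeasurableI) auto
  qed
  also have "\<dots> = d - c"
    using assms(2) by simp
  finally show ?thesis .
qed

text \<open>
  A free action on the circle together with a choice of lifts. The lifts compose only up to integer
  translations; lengths of image intervals do not depend on the choice.
\<close>

locale free_lifted_action = group_action G unit_circle \<phi>
  for G (structure) and \<phi> :: "'g \<Rightarrow> complex \<Rightarrow> complex" +
  fixes F :: "'g \<Rightarrow> real \<Rightarrow> real"
  assumes lift: "g \<in> carrier G \<Longrightarrow> is_lift (F g) (\<phi> g)"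
    and mono: "g \<in> carrier G \<Longrightarrow> strict_mono (F g)"
    and period: "g \<in> carrier G \<Longrightarrow> F g (x + 1) = F g x + 1"
    and free: "free_action G unit_circle \<phi>"
begin

sublocale group G
  using group_hom group_hom.axioms(1) by blast

lemma F_add_int:
  assumes "g \<in> carrier G"
  shows "F g (x + of_int k) = F g x + of_int k"
proof (induction k rule: int_induct[where k = 0])
  case (step1 i)
  then show ?case using period[OF assms, of "x + of_int i"] by (simp add: add.assoc)
next
  case (step2 i)
  then show ?case using period[OF assms, of "x + of_int i - 1"] by (simp add: algebra_simps)
qed simp

lemma F_continuous: "g \<in> carrier G \<Longrightarrow> continuous_on A (F g)"
  using lift continuous_on_subset[of UNIV "F g" A] by (auto simp: is_lift_def)

lemma F_mult:
  assumes "g \<in> carrier G" "h \<in> carrier G"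
  obtains k :: int where "\<And>x. F (g \<otimes> h) x = F g (F h x) + of_int k"
proof -
  have "is_lift (F g \<circ> F h) (\<phi> (g \<otimes> h))"
    by (rule is_lift_cong[OF is_lift_comp[OF lift[OF assms(1)] lift[OF assms(2)]]])
       (use assms composition_rule in simp)
  from is_lift_unique[OF this lift] assms show thesis
    using that by auto
qed

lemma F_one: obtains k :: int where "\<And>x. F \<one> x = x + of_int k"
proof -
  have "is_lift id (\<phi> \<one>)"
    by (rule is_lift_cong[OF is_lift_id]) (use id_eq_one in \<open>metis id_apply restrict_apply'\<close>)
  from is_lift_unique[OF this lift] show thesis
    using that by auto
qed

lemma fixed_imp_one:
  assumes "g \<in> carrier G" "F g x = x + of_int k"
  shows "g = \<one>"
proof (rule ccontr)
  assume "g \<noteq> \<one>"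
  have "\<phi> g (circ x) = circ (F g x)"
    using lift[OF assms(1)] by (simp add: is_lift_def)
  also have "\<dots> = circ x" by (simp add: assms(2))
  finally show False
    using free assms(1) \<open>g \<noteq> \<one>\<close> circ_in_circle[of x] unfolding free_action_def by blast
qed

lemma F_inv:
  assumes "g \<in> carrier G"
  obtains k :: int where "\<And>x. F (inv g) (F g x) = x + of_int k"
proof -
  obtain c :: int where c: "\<And>x. F \<one> x = x + of_int c" using F_one by blast
  obtain k :: int where k: "\<And>x. F (inv g \<otimes> g) x = F (inv g) (F g x) + of_int k"
    using F_mult[OF inv_closed[OF assms] assms] by blast
  have "F (inv g) (F g x) = x + of_int (c - k)" for x
    using k[of x] c[of x] l_inv[OF assms] by simp
  then show thesis by (rule that)
qed

lemma F_eq_imp_eq: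
  assumes g: "g \<in> carrier G" and h: "h \<in> carrier G" and eq: "F g x = F h x + of_int j"
  shows "g = h"
proof -
  obtain k :: int where k: "\<And>x. F (inv h \<otimes> g) x = F (inv h) (F g x) + of_int k"
    using F_mult[OF inv_closed[OF h] g] by blast
  obtain c :: int where c: "\<And>x. F (inv h) (F h x) = x + of_int c"
    using F_inv[OF h] by blast
  have "F (inv h \<otimes> g) x = x + of_int (c + j + k)"
    using F_add_int[of "inv h" "F h x" j] h by (simp add: k eq c)
  from fixed_imp_one[OF _ this] have "inv h \<otimes> g = \<one>"
    using g h by simp
  then show "g = h"
    using g h by (metis inv_closed inv_equality inv_inv)
qed

text \<open>
  The preimages in the line of orbits and of closed invariant sets of the circle.
\<close>

definition lifted_orbit :: "real \<Rightarrow> real set"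
  where "lifted_orbit x = {F g x + of_int k | g k. g \<in> carrier G}"

definition invariant_closed :: "real set \<Rightarrow> bool"
  where "invariant_closed K \<longleftrightarrow>
    closed K \<and> K \<noteq> {} \<and> (\<forall>x\<in>K. \<forall>g\<in>carrier G. \<forall>k::int. F g x + of_int k \<in> K)"

lemma invariant_closed_add_int:
  assumes "invariant_closed K" "x \<in> K"
  shows "x + of_int k \<in> K"
proof -
  obtain c :: int where c: "\<And>x. F \<one> x = x + of_int c" using F_one by blast
  have "F \<one> x + of_int (k - c) \<in> K"
    using assms unfolding invariant_closed_def by blast
  then show ?thesis by (simp add: c)
qed

lemma invariant_closed_F: "invariant_closed K \<Longrightarrow> x \<in> K \<Longrightarrow> g \<in> carrier G \<Longrightarrow> F g x \<in> K"
  unfolding invariant_closed_def by (metis add.right_neutral of_int_0)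

lemma invariant_closed_F_iff:
  assumes "invariant_closed K" "g \<in> carrier G"
  shows "F g x \<in> K \<longleftrightarrow> x \<in> K"
proof
  assume "F g x \<in> K"
  then have 1: "F (inv g) (F g x) \<in> K"
    using invariant_closed_F[OF assms(1) _ inv_closed[OF assms(2)]] by blast
  obtain k :: int where "\<And>x. F (inv g) (F g x) = x + of_int k"
    using F_inv[OF assms(2)] by blast
  with 1 invariant_closed_add_int[OF assms(1), of "F (inv g) (F g x)" "- k"] show "x \<in> K"
    by simp
qed (use assms invariant_closed_F in blast)

lemma invariant_closed_meets_unit_interval:
  assumes "invariant_closed K"
  shows "K \<inter> {0..1} \<noteq> {}"
proof -
  obtain x where "x \<in> K" using assms by (auto simp: invariant_closed_def)
  then have "x + of_int (- \<lfloor>x\<rfloor>) \<in> K"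
    by (rule invariant_closed_add_int[OF assms])
  moreover have "x + of_int (- \<lfloor>x\<rfloor>) \<in> {0..1}"
    using frac_lt_1[of x] frac_ge_0[of x] by (simp add: frac_def)
  ultimately show ?thesis by blast
qed

lemma invariant_closed_orbit_closure: "invariant_closed (closure (lifted_orbit x))"
proof -
  have "(\<lambda>y. F g y + of_int k) ` closure (lifted_orbit x) \<subseteq> closure (lifted_orbit x)"
    if g: "g \<in> carrier G" for g k
  proof (rule image_closure_subset)
    show "(\<lambda>y. F g y + of_int k) ` lifted_orbit x \<subseteq> closure (lifted_orbit x)"
    proof
      fix z assume "z \<in> (\<lambda>y. F g y + of_int k) ` lifted_orbit x"
      then obtain h j where h: "h \<in> carrier G" "z = F g (F h x + of_int j) + of_int k"
        by (auto simp: lifted_orbit_def)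
      obtain m :: int where m: "\<And>x. F (g \<otimes> h) x = F g (F h x) + of_int m"
        using F_mult[OF g h(1)] by blast
      have "z = F (g \<otimes> h) x + of_int (j + k - m)"
        using h(2) F_add_int[OF g, of "F h x" j] by (simp add: m)
      then have "z \<in> lifted_orbit x"
        using g h(1) unfolding lifted_orbit_def by blast
      then show "z \<in> closure (lifted_orbit x)"
        using closure_subset by blast
    qed
  qed (auto intro!: continuous_intros F_continuous g)
  moreover have "lifted_orbit x \<noteq> {}"
    by (auto simp: lifted_orbit_def)
  ultimately show ?thesis
    by (auto simp: invariant_closed_def)
qed

text \<open>
  Zorn's lemma for the complements. Intersections of chains stay nonempty because every set of the
  family meets the compact interval \<open>[0, 1]\<close>.
\<close>

lemma exists_minimal_invariant_closed:
  assumes K0: "invariant_closed K0"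
  obtains K where "invariant_closed K" "K \<subseteq> K0"
    "\<And>y. y \<in> K \<Longrightarrow> K \<subseteq> closure (lifted_orbit y)"
proof -
  define \<A> where "\<A> = {U. invariant_closed (- U) \<and> - K0 \<subseteq> U}"
  have "\<exists>M\<in>\<A>. \<forall>V\<in>\<A>. M \<subseteq> V \<longrightarrow> V = M"
  proof (rule Zorn_Lemma2, rule ballI)
    fix C assume C: "C \<in> chains \<A>"
    then have CA: "C \<subseteq> \<A>" and lin: "\<And>U V. U \<in> C \<Longrightarrow> V \<in> C \<Longrightarrow> U \<subseteq> V \<or> V \<subseteq> U"
      by (auto simp: chains_def chain_subset_def)
    show "\<exists>U\<in>\<A>. \<forall>V\<in>C. V \<subseteq> U"
    proof (cases "C = {}")
      case True
      then show ?thesis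
        using K0 by (intro bexI[of _ "- K0"]) (auto simp: \<A>_def)
    next
      case False
      have inv: "invariant_closed (- U)" if "U \<in> C" for U
        using that CA by (auto simp: \<A>_def)
      have "\<Inter> ((\<lambda>U. - U \<inter> {0..1}) ` C) \<noteq> {}"
      proof (rule compact_chain)
        show "compact S" if "S \<in> (\<lambda>U. - U \<inter> {0..1}) ` C" for S
          using that inv by (auto simp: invariant_closed_def intro!: closed_Int_compact)
        show "{} \<notin> (\<lambda>U. - U \<inter> {0..1}) ` C"
          using inv invariant_closed_meets_unit_interval by auto
        show "S \<subseteq> T \<or> T \<subseteq> S"
          if "S \<in> (\<lambda>U. - U \<inter> {0..1}) ` C \<and> T \<in> (\<lambda>U. - U \<inter> {0..1}) ` C" for S T
          using that lin by blast
      qed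
      then obtain x where x: "x \<in> \<Inter> ((\<lambda>U. - U \<inter> {0..1}) ` C)" by (meson ex_in_conv)
      have "x \<notin> U" if "U \<in> C" for U
        using InterD[OF x imageI[OF that]] by simp
      then have "- \<Union> C \<noteq> {}" by blast
      moreover have "closed (- \<Union> C)"
        using inv by (auto simp: invariant_closed_def closed_def intro!: open_Union)
      moreover have "F g x + of_int k \<in> - \<Union> C" if "x \<in> - \<Union> C" "g \<in> carrier G" for x g k
        using inv that by (auto simp: invariant_closed_def)
      ultimately have "invariant_closed (- \<Union> C)"
        unfolding invariant_closed_def by blast
      then show ?thesis
        using False CA by (intro bexI[of _ "\<Union> C"]) (auto simp: \<A>_def)
    qed
  qed
  then obtain M where M: "M \<in> \<A>" "\<And>V. V \<in> \<A> \<Longrightarrow> M \<subseteq> V \<Longrightarrow> V = M" by blast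
  define K where "K = - M"
  have K: "invariant_closed K" "K \<subseteq> K0"
    using M(1) by (auto simp: K_def \<A>_def)
  have "K \<subseteq> closure (lifted_orbit y)" if "y \<in> K" for y
  proof -
    have "closure (lifted_orbit y) \<subseteq> K"
      using K(1) that by (intro closure_minimal) (auto simp: lifted_orbit_def invariant_closed_def)
    then have "- closure (lifted_orbit y) = M"
      using invariant_closed_orbit_closure[of y] K(2) by (intro M(2)) (auto simp: \<A>_def K_def)
    then show ?thesis by (auto simp: K_def)
  qed
  with K show thesis by (rule that)
qed

lemma not_minimal_imp_proper:
  assumes "\<not> minimal_action G unit_circle \<phi>"
  obtains x where "closure (lifted_orbit x) \<noteq> UNIV"
proof -
  obtain w z where wz: "w \<in> unit_circle" "z \<in> unit_circle" "z \<notin> closure (orbit G \<phi> w)"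
    using assms unfolding minimal_action_def by blast
  obtain x where x: "w = circ x" by (rule circ_surj[OF wz(1)])
  obtain s where s: "z = circ s" by (rule circ_surj[OF wz(2)])
  have "circ ` closure (lifted_orbit x) \<subseteq> closure (orbit G \<phi> w)"
  proof (rule image_closure_subset)
    have "circ (F g x + of_int k) \<in> orbit G \<phi> w" if "g \<in> carrier G" for g k
    proof -
      have "circ (F g x + of_int k) = \<phi> g w"
        using lift[OF that] by (simp add: is_lift_def x)
      with that show ?thesis by (auto simp: orbit_def)
    qed
    then show "circ ` lifted_orbit x \<subseteq> closure (orbit G \<phi> w)"
      using closure_subset[of "orbit G \<phi> w"] by (auto simp: lifted_orbit_def simp del: circ_add_int)
  qed (auto intro!: continuous_intros)
  then have "s \<notin> closure (lifted_orbit x)"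
    using wz(3) s by blast
  then show thesis by (intro that[of x]) blast
qed

definition gap :: "real set \<Rightarrow> real \<Rightarrow> real \<Rightarrow> bool"
  where "gap K a b \<longleftrightarrow> a < b \<and> a \<in> K \<and> b \<in> K \<and> {a<..<b} \<inter> K = {}"

lemma gaps_disjoint:
  assumes "gap K a b" "gap K a' b'" "a \<noteq> a'"
  shows "{a<..<b} \<inter> {a'<..<b'} = {}"
proof -
  have "q \<le> p'" if "gap K p q" "gap K p' q'" "p < p'" for p q p' q'
  proof (rule ccontr)
    assume "\<not> q \<le> p'"
    then have "p' \<in> {p<..<q} \<inter> K" using that(2,3) by (simp add: gap_def)
    with that(1) show False unfolding gap_def by blast
  qed
  from this[of a b a' b'] this[of a' b' a b] assms show ?thesis
    by (cases a a' rule: linorder_cases) auto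
qed

text \<open>
  A lift is onto and maps neither \<open>K\<close> nor its complement into the other, so it permutes the gaps.
\<close>

lemma gap_F:
  assumes K: "invariant_closed K" and ab: "gap K a b" and g: "g \<in> carrier G"
  shows "gap K (F g a + of_int k) (F g b + of_int k)"
proof -
  have "u \<notin> K" if u: "F g a + of_int k < u" "u < F g b + of_int k" for u
  proof -
    obtain t where t: "a \<le> t" "t \<le> b" "F g t = u - of_int k"
      using IVT'[of "F g" a "u - of_int k" b] u ab F_continuous[OF g] by (auto simp: gap_def)
    then have "a < t" "t < b"
      using u by (auto simp: less_le)
    then have "t \<notin> K" using ab by (auto simp: gap_def)
    then have "u - of_int k \<notin> K"
      using invariant_closed_F_iff[OF K g] t(3) by metis
    then show ?thesis
      using invariant_closed_add_int[OF K, of u "- k"] by auto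
  qed
  moreover have "F g a < F g b"
    using mono[OF g] ab by (simp add: strict_mono_def gap_def)
  ultimately show ?thesis
    using ab K g unfolding gap_def invariant_closed_def by auto
qed

lemma exists_gap:
  assumes K: "invariant_closed K" "K \<noteq> UNIV"
  obtains a b where "gap K a b"
proof -
  obtain t where t: "t \<notin> K" using K(2) by blast
  have cl: "closed K" using K(1) by (simp add: invariant_closed_def)
  obtain x where x: "x \<in> K" using K(1) by (auto simp: invariant_closed_def)
  have "x + of_int \<lfloor>t - x\<rfloor> \<le> t" "t \<le> x + of_int \<lceil>t - x\<rceil>"
    by linarith+
  then have "x + of_int \<lfloor>t - x\<rfloor> \<in> K \<inter> {..t}" "x + of_int \<lceil>t - x\<rceil> \<in> K \<inter> {t..}"
    using invariant_closed_add_int[OF K(1) x] by auto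
  then have ne: "K \<inter> {..t} \<noteq> {}" "K \<inter> {t..} \<noteq> {}" by blast+
  define a b where "a = Sup (K \<inter> {..t})" and "b = Inf (K \<inter> {t..})"
  have bdd: "bdd_above (K \<inter> {..t})" "bdd_below (K \<inter> {t..})"
    by (auto intro: bdd_aboveI[of _ t] bdd_belowI[of _ t])
  have "a \<in> K \<inter> {..t}" "b \<in> K \<inter> {t..}"
    unfolding a_def b_def
    by (rule closed_contains_Sup[OF ne(1) bdd(1)] closed_contains_Inf[OF ne(2) bdd(2)],
        intro closed_Int cl closed_atMost closed_atLeast)+
  moreover have "u \<notin> K" if "a < u" "u < b" for u
  proof
    assume "u \<in> K"
    show False
    proof (cases "u \<le> t")
      case True
      then have "u \<le> a" using \<open>u \<in> K\<close> bdd unfolding a_def by (intro cSup_upper) auto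
      with that show False by simp
    next
      case False
      then have "b \<le> u" using \<open>u \<in> K\<close> bdd unfolding b_def by (intro cInf_lower) auto
      with that show False by simp
    qed
  qed
  moreover have "a \<noteq> t" "b \<noteq> t" using calculation t by auto
  ultimately have "gap K a b" by (auto simp: gap_def)
  then show thesis by (rule that)
qed

text \<open>
  By freeness, distinct group elements move \<open>a\<close> to points that differ modulo 1, so the images of the
  gap are pairwise distinct gaps on the circle, and distinct gaps are disjoint. Translated into one
  fundamental domain that starts at a point of \<open>K\<close>, they all fit into it.
\<close>

lemma sum_gap_lengths_le_1:
  assumes K: "invariant_closed K" and ab: "gap K a b"
    and S: "finite S" "S \<subseteq> carrier G"
  shows "(\<Sum>g\<in>S. F g b - F g a) \<le> 1"
proof (cases "S = {}")
  case False
  then obtain g0 where g0: "g0 \<in> S" by blast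
  define c where "c = F g0 a"
  define n where "n g = - \<lfloor>F g a - c\<rfloor>" for g
  define l r where "l g = F g a + of_int (n g)" and "r g = F g b + of_int (n g)" for g
  have gap: "gap K (l g) (r g)" if "g \<in> S" for g
    unfolding l_def r_def using gap_F[OF K ab] that S by blast
  have c: "c + 1 \<in> K"
    using gap_F[OF K ab, of g0 1] g0 S by (auto simp: c_def gap_def)
  have bounds: "c \<le> l g \<and> l g < c + 1" for g
    unfolding l_def n_def by simp linarith
  have r: "r g \<le> c + 1" if "g \<in> S" for g
    using gap[OF that] bounds[of g] c by (force simp: gap_def)
  have "disjoint_family_on (\<lambda>g. {l g<..<r g}) S"
  proof (unfold disjoint_family_on_def, intro ballI impI)
    fix g h assume gh: "g \<in> S" "h \<in> S" "g \<noteq> h"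
    have "l g \<noteq> l h"
    proof
      assume "l g = l h"
      then have "F g a = F h a + of_int (n h - n g)" by (simp add: l_def algebra_simps)
      then show False using F_eq_imp_eq[of g h] gh S by blast
    qed
    then show "{l g<..<r g} \<inter> {l h<..<r h} = {}"
      by (rule gaps_disjoint[OF gap[OF gh(1)] gap[OF gh(2)]])
  qed
  then have "(\<Sum>g\<in>S. r g - l g) \<le> (c + 1) - c"
    using S(1) bounds r gap by (intro sum_disjoint_intervals_le) (auto simp: gap_def less_imp_le)
  then show ?thesis by (simp add: l_def r_def)
qed simp

text \<open>
  If the images of \<open>[a - \<delta>, b + \<delta>]\<close> shrank to points, a subsequence of them would converge modulo 1
  to some \<open>p\<close> in \<open>K\<close>. By minimality a fixed group element \<open>h\<close> brings \<open>p\<close> close to \<open>a\<close>, so \<open>h\<close> composed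
  with late members of the sequence maps the interval into itself and has a fixed point there.
  Freeness then makes these compositions trivial, although the members are distinct.
\<close>

lemma neighbourhood_not_contracted:
  assumes K: "invariant_closed K" and min: "\<And>y. y \<in> K \<Longrightarrow> K \<subseteq> closure (lifted_orbit y)"
    and a: "a \<in> K" "a \<le> b" and \<delta>: "\<delta> > 0"
    and \<gamma>: "range \<gamma> \<subseteq> carrier G" "inj \<gamma>"
  shows "\<not> (\<lambda>n::nat. F (\<gamma> n) (b + \<delta>) - F (\<gamma> n) (a - \<delta>)) \<longlonglongrightarrow> 0"
proof
  assume lim: "(\<lambda>n. F (\<gamma> n) (b + \<delta>) - F (\<gamma> n) (a - \<delta>)) \<longlonglongrightarrow> 0"
  have \<gamma>G: "\<gamma> n \<in> carrier G" for n using \<gamma>(1) by auto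
  define k where "k n = - \<lfloor>F (\<gamma> n) a\<rfloor>" for n
  define x where "x n = F (\<gamma> n) a + of_int (k n)" for n
  have "x n \<in> K \<inter> {0..1}" for n
  proof -
    have "x n = frac (F (\<gamma> n) a)" by (simp add: x_def k_def frac_def)
    then have "0 \<le> x n" "x n \<le> 1" by (simp_all add: frac_lt_1 less_imp_le)
    moreover have "x n \<in> K"
      using K a(1) \<gamma>G[of n] unfolding invariant_closed_def x_def by blast
    ultimately show ?thesis by simp
  qed
  moreover have "compact (K \<inter> {0..1})"
    using K by (auto simp: invariant_closed_def intro: closed_Int_compact)
  ultimately obtain p r where p: "p \<in> K \<inter> {0..1}" and r: "strict_mono r" and conv: "(x \<circ> r) \<longlonglongrightarrow> p"
    unfolding compact_def by metis
  have "a \<in> closure (lifted_orbit p)" using min p a by blast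
  then obtain y where "y \<in> lifted_orbit p" "dist y a < \<delta>"
    using \<delta> by (auto simp: closure_approachable)
  then obtain h m where h: "h \<in> carrier G" and ya: "\<bar>F h p + of_int m - a\<bar> < \<delta>"
    by (auto simp: lifted_orbit_def dist_real_def)
  define H where "H y = F h y + of_int m" for y
  have contH: "continuous_on UNIV H"
    unfolding H_def by (intro continuous_intros F_continuous h)
  have "\<forall>\<^sub>F y in nhds p. \<bar>H y - a\<bar> < \<delta>"
  proof -
    have "open (H -` {a - \<delta><..<a + \<delta>})"
      by (rule open_vimage[OF open_greaterThanLessThan contH])
    moreover have "p \<in> H -` {a - \<delta><..<a + \<delta>}"
      using ya by (auto simp: H_def)
    ultimately have "\<forall>\<^sub>F y in nhds p. y \<in> H -` {a - \<delta><..<a + \<delta>}"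
      by (rule eventually_nhds_in_open)
    then show ?thesis by (rule eventually_mono) auto
  qed
  then obtain \<eta> where \<eta>: "\<eta> > 0" "\<And>y. \<bar>y - p\<bar> < \<eta> \<Longrightarrow> \<bar>H y - a\<bar> < \<delta>"
    by (auto simp: eventually_nhds_metric dist_real_def)
  have "\<forall>\<^sub>F n in sequentially. \<bar>x (r n) - p\<bar> < \<eta> / 2"
    using tendstoD[OF conv, of "\<eta> / 2"] \<eta>(1) by (simp add: dist_real_def)
  moreover have "\<forall>\<^sub>F n in sequentially. \<bar>F (\<gamma> (r n)) (b + \<delta>) - F (\<gamma> (r n)) (a - \<delta>)\<bar> < \<eta> / 2"
    using tendstoD[OF LIMSEQ_subseq_LIMSEQ[OF lim r], of "\<eta> / 2"] \<eta>(1) by (simp add: dist_real_def)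
  ultimately have "\<forall>\<^sub>F n in sequentially. h \<otimes> \<gamma> (r n) = \<one>"
  proof eventually_elim
    case (elim n)
    define g where "g = \<gamma> (r n)"
    have g: "g \<in> carrier G" using \<gamma>G by (simp add: g_def)
    define T where "T y = H (F g y + of_int (k (r n)))" for y
    have self: "a - \<delta> \<le> T y \<and> T y \<le> b + \<delta>" if y: "a - \<delta> \<le> y" "y \<le> b + \<delta>" for y
    proof -
      have "F g (a - \<delta>) \<le> F g y" "F g y \<le> F g (b + \<delta>)" "F g (a - \<delta>) \<le> F g a" "F g a \<le> F g (b + \<delta>)"
        using y a(2) \<delta> by (auto simp: strict_mono_less_eq[OF mono[OF g]])
      then have "\<bar>F g y + of_int (k (r n)) - p\<bar> < \<eta>"
        using elim unfolding x_def g_def by linarith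
      then have "\<bar>T y - a\<bar> < \<delta>" unfolding T_def by (rule \<eta>(2))
      then show ?thesis using a(2) by linarith
    qed
    have "continuous_on {a - \<delta>..b + \<delta>} (\<lambda>y. T y - y)"
      unfolding T_def H_def
      by (intro continuous_intros continuous_on_compose2[OF F_continuous[OF h, of UNIV]] F_continuous g) auto
    then obtain y where "T y - y = 0"
      using IVT2'[of "\<lambda>y. T y - y" "b + \<delta>" 0 "a - \<delta>"] self[of "a - \<delta>"] self[of "b + \<delta>"] a(2) \<delta> by auto
    moreover obtain j :: int where "\<And>x. F (h \<otimes> g) x = F h (F g x) + of_int j"
      using F_mult[OF h g] by blast
    ultimately have "F (h \<otimes> g) y = y + of_int (j - k (r n) - m)"
      using F_add_int[OF h, of "F g y" "k (r n)"] by (simp add: T_def H_def)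
    from fixed_imp_one[OF _ this] show "h \<otimes> \<gamma> (r n) = \<one>"
      using h g by (simp add: g_def)
  qed
  then obtain N where N: "\<And>n. n \<ge> N \<Longrightarrow> h \<otimes> \<gamma> (r n) = \<one>"
    by (auto simp: eventually_sequentially)
  have "h \<otimes> \<gamma> (r N) = h \<otimes> \<gamma> (r (Suc N))"
    using N[of N] N[of "Suc N"] by simp
  then have "\<gamma> (r N) = \<gamma> (r (Suc N))"
    using h \<gamma>G by simp
  then have "r N = r (Suc N)" using \<gamma>(2) by (simp add: inj_eq)
  then show False using r by (metis lessI less_irrefl strict_mono_less)
qed

text \<open>
  The interval is a gap of a minimal set inside a proper orbit closure. Its images are disjoint on
  the circle, but a neighbourhood cannot be contracted along any sequence, since the endpoints
  belong to the minimal set and are recurrent.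
\<close>

proposition nonminimal_wandering_interval:
  assumes "\<not> minimal_action G unit_circle \<phi>"
  obtains a b where "a < b"
    "\<And>S. finite S \<Longrightarrow> S \<subseteq> carrier G \<Longrightarrow> (\<Sum>g\<in>S. F g b - F g a) \<le> 1"
    "\<And>\<delta> \<gamma>. \<delta> > 0 \<Longrightarrow> range \<gamma> \<subseteq> carrier G \<Longrightarrow> inj \<gamma> \<Longrightarrow>
       \<not> (\<lambda>n::nat. F (\<gamma> n) (b + \<delta>) - F (\<gamma> n) (a - \<delta>)) \<longlonglongrightarrow> 0"
proof -
  obtain x where x: "closure (lifted_orbit x) \<noteq> UNIV"
    by (rule not_minimal_imp_proper[OF assms])
  obtain K where K: "invariant_closed K" "K \<subseteq> closure (lifted_orbit x)"
    "\<And>y. y \<in> K \<Longrightarrow> K \<subseteq> closure (lifted_orbit y)"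
    using exists_minimal_invariant_closed[OF invariant_closed_orbit_closure[of x]] by blast
  then have "K \<noteq> UNIV" using x by blast
  then obtain a b where ab: "gap K a b"
    using exists_gap[OF K(1)] by blast
  show thesis
  proof (rule that)
    show "a < b" using ab by (simp add: gap_def)
    show "(\<Sum>g\<in>S. F g b - F g a) \<le> 1" if "finite S" "S \<subseteq> carrier G" for S
      by (rule sum_gap_lengths_le_1[OF K(1) ab that])
    show "\<not> (\<lambda>n::nat. F (\<gamma> n) (b + \<delta>) - F (\<gamma> n) (a - \<delta>)) \<longlonglongrightarrow> 0"
      if "\<delta> > 0" "range \<gamma> \<subseteq> carrier G" "inj \<gamma>" for \<delta> \<gamma>
      by (rule neighbourhood_not_contracted[OF K(1) K(3) _ _ that]) (use ab in \<open>auto simp: gap_def\<close>)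
  qed
qed

end

section \<open>Actions of free abelian groups\<close>

text \<open>
  The inclusion of the cone \<open>\<nat>\<^sup>d\<close> into \<open>\<int>\<^sup>d\<close>, whose elements are extensional on \<open>{..<d}\<close>.
\<close>

definition to_Z_power :: "nat \<Rightarrow> (nat \<Rightarrow> nat) \<Rightarrow> nat \<Rightarrow> int"
  where "to_Z_power d v = (\<lambda>i\<in>{..<d}. int (v i))"

lemma to_Z_power_closed [simp]: "to_Z_power d v \<in> carrier (Z_power d)"
  by (simp add: to_Z_power_def Z_power_def integer_group_def)

lemma to_Z_power_zero: "to_Z_power d (\<lambda>_. 0) = \<one>\<^bsub>Z_power d\<^esub>"
  by (simp add: to_Z_power_def Z_power_def integer_group_def)

lemma to_Z_power_add:
  "to_Z_power d (\<lambda>i. u i + v i) = to_Z_power d u \<otimes>\<^bsub>Z_power d\<^esub> to_Z_power d v"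
  by (auto simp: to_Z_power_def Z_power_def integer_group_def)

lemma to_Z_power_eq_iff: "to_Z_power d u = to_Z_power d v \<longleftrightarrow> (\<forall>i<d. u i = v i)"
  by (auto simp: to_Z_power_def fun_eq_iff restrict_def)

text \<open>
  Commutativity of \<open>\<int>\<^sup>d\<close> enters here: the group element of a word depends only on the letter counts,
  so that the word maps of all paths that end at the same point of the cone agree up to an integer translation.
\<close>

lemma word_map_is_lift:
  assumes act: "group_action (Z_power d) unit_circle \<phi>"
    and lift: "\<And>i. i < d \<Longrightarrow> is_lift (F i) (\<phi> (to_Z_power d (count_list [i])))"
  shows "set s \<subseteq> {..<d} \<Longrightarrow> is_lift (word_map F s) (\<phi> (to_Z_power d (count_list s)))"
proof (induction s)
  case Nil
  interpret group_action "Z_power d" unit_circle \<phi> by (rule act)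
  have "to_Z_power d (count_list []) = \<one>\<^bsub>Z_power d\<^esub>"
    unfolding to_Z_power_zero[symmetric] by (simp add: to_Z_power_eq_iff)
  moreover have "is_lift id (\<phi> \<one>\<^bsub>Z_power d\<^esub>)"
    by (rule is_lift_cong[OF is_lift_id]) (use id_eq_one in \<open>metis id_apply restrict_apply'\<close>)
  moreover have "word_map F [] = id" by (simp add: word_map_def)
  ultimately show ?case by (simp only:)
next
  case (Cons i s)
  interpret group_action "Z_power d" unit_circle \<phi> by (rule act)
  have prod: "to_Z_power d (count_list (i # s))
      = to_Z_power d (count_list [i]) \<otimes>\<^bsub>Z_power d\<^esub> to_Z_power d (count_list s)"
    unfolding to_Z_power_add[symmetric] by (simp add: to_Z_power_eq_iff)
  have "is_lift (F i \<circ> word_map F s)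
      (\<phi> (to_Z_power d (count_list [i])) \<circ> \<phi> (to_Z_power d (count_list s)))"
    using Cons lift by (intro is_lift_comp) auto
  then have "is_lift (F i \<circ> word_map F s) (\<phi> (to_Z_power d (count_list (i # s))))"
    unfolding prod by (rule is_lift_cong) (simp add: composition_rule del: count_list.simps)
  moreover have "F i \<circ> word_map F s = word_map F (i # s)"
    by (simp add: word_map_def)
  ultimately show ?case by (simp only:)
qed

theorem mainTheorem1:
  fixes d :: nat and \<epsilon> :: real
    and \<phi> :: "(nat \<Rightarrow> int) \<Rightarrow> complex \<Rightarrow> complex"
  assumes "d \<ge> 2" and "\<epsilon> > 0"
    and "group_action (Z_power d) unit_circle \<phi>"
    and "\<And>g. g \<in> carrier (Z_power d) \<Longrightarrow>
           circle_diffeo (\<phi> g) \<and> orientation_preserving (\<phi> g) \<and>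
           circle_C_class (1 + 1 / real d + \<epsilon>) (\<phi> g)"
    and "free_action (Z_power d) unit_circle \<phi>"
  shows "minimal_action (Z_power d) unit_circle \<phi>"
proof (rule ccontr)
  assume nonmin: "\<not> minimal_action (Z_power d) unit_circle \<phi>"
  have "1 / real d < 1" using assms(1) by simp
  \<comment> \<open>Young's inequality needs an exponent below 1, so regularity is given away if \<open>1/d + \<epsilon>\<close> is
    larger.\<close>
  then obtain \<tau> where \<tau>: "1 / real d < \<tau>" "\<tau> < min 1 (1 / real d + \<epsilon>)"
    using dense[of "1 / real d" "min 1 (1 / real d + \<epsilon>)"] assms(2) by auto
  have \<tau>0: "\<tau> > 0" using \<tau>(1) by (smt (verit) divide_nonneg_nonneg of_nat_0_le_iff)
  define regular where "regular g T \<longleftrightarrow> (case T of (F, F', \<kappa>) \<Rightarrow>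
      is_lift F (\<phi> g) \<and> strict_mono F \<and> (\<forall>x. F (x + 1) = F x + 1) \<and>
      (\<forall>x. (F has_real_derivative F' x) (at x) \<and> F' x > 0) \<and>
      \<kappa> \<ge> 0 \<and> (\<forall>x y. \<bar>ln (F' x) - ln (F' y)\<bar> \<le> \<kappa> * \<bar>x - y\<bar> powr \<tau>))" for g T
  have "\<exists>T. regular g T" if g: "g \<in> carrier (Z_power d)" for g
  proof -
    have f: "circle_diffeo (\<phi> g)" "orientation_preserving (\<phi> g)"
      "circle_C_class (1 + (1 / real d + \<epsilon>)) (\<phi> g)"
      using assms(4)[OF g] by (simp_all add: add.assoc)
    have "\<tau> < 1" "\<tau> \<le> 1 / real d + \<epsilon>" using \<tau>(2) by auto
    then show ?thesis
    proof (rule circle_diffeo_lift[OF f \<tau>0])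
      fix F F' \<kappa>
      assume "is_lift F (\<phi> g)" "strict_mono F" "\<And>x. F (x + 1) = F x + 1"
        "\<And>x. (F has_real_derivative F' x) (at x)" "\<And>x. F' x > 0"
        "\<kappa> \<ge> 0" "\<And>x y. \<bar>ln (F' x) - ln (F' y)\<bar> \<le> \<kappa> * \<bar>x - y\<bar> powr \<tau>"
      then show ?thesis
        by (intro exI[of _ "(F, F', \<kappa>)"]) (simp add: regular_def)
    qed
  qed
  then obtain T where T: "\<And>g. g \<in> carrier (Z_power d) \<Longrightarrow> regular g (T g)"
    using bchoice[of "carrier (Z_power d)" regular] by blast
  define F F' \<kappa> where "F g = fst (T g)" and "F' g = fst (snd (T g))" and "\<kappa> g = snd (snd (T g))" for g
  have F: "is_lift (F g) (\<phi> g)" "strict_mono (F g)" "F g (x + 1) = F g x + 1"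
    and F': "(F g has_real_derivative F' g x) (at x)" "F' g x > 0"
    and \<kappa>: "\<kappa> g \<ge> 0" "\<bar>ln (F' g x) - ln (F' g y)\<bar> \<le> \<kappa> g * \<bar>x - y\<bar> powr \<tau>"
    if "g \<in> carrier (Z_power d)" for g x y
    using T[OF that] by (auto simp: regular_def F_def F'_def \<kappa>_def split: prod.splits)
  interpret group_action "Z_power d" unit_circle \<phi> by (rule assms(3))
  interpret free_lifted_action "Z_power d" \<phi> F
    by unfold_locales (use F assms(5) in auto)
  obtain a b where ab: "a < b"
    and sum1: "\<And>S. finite S \<Longrightarrow> S \<subseteq> carrier (Z_power d) \<Longrightarrow> (\<Sum>g\<in>S. F g b - F g a) \<le> 1"
    and no_contraction: "\<And>\<delta> \<gamma>. \<delta> > 0 \<Longrightarrow> range \<gamma> \<subseteq> carrier (Z_power d) \<Longrightarrow> inj \<gamma> \<Longrightarrow>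
       \<not> (\<lambda>n::nat. F (\<gamma> n) (b + \<delta>) - F (\<gamma> n) (a - \<delta>)) \<longlonglongrightarrow> 0"
    using nonminimal_wandering_interval[OF nonmin] by blast

  define len where "len g = F g b - F g a" for g
  have len_pos: "len g > 0" if "g \<in> carrier (Z_power d)" for g
    using F(2)[OF that] ab by (simp add: len_def strict_mono_def)
  have "sum (\<lambda>v. len (to_Z_power d v)) S \<le> 1"
    if S: "finite S" "S \<subseteq> {v. \<forall>i\<ge>d. v i = 0}" for S
  proof -
    have "inj_on (to_Z_power d) S"
    proof (rule inj_onI)
      fix u v assume "u \<in> S" "v \<in> S" "to_Z_power d u = to_Z_power d v"
      moreover from this have "\<forall>i\<ge>d. u i = 0" "\<forall>i\<ge>d. v i = 0"
        using S(2) by auto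
      ultimately have "u i = v i" for i
        by (cases "i < d") (auto simp: to_Z_power_eq_iff)
      then show "u = v" by auto
    qed
    then have "sum (\<lambda>v. len (to_Z_power d v)) S = sum len (to_Z_power d ` S)"
      by (simp add: sum.reindex)
    also have "\<dots> \<le> 1"
      unfolding len_def by (rule sum1) (use S in auto)
    finally show ?thesis .
  qed
  then obtain C where C: "\<And>n. \<exists>s. set s \<subseteq> {..<d} \<and> length s = n \<and>
      word_cost (\<lambda>v. len (to_Z_power d v) powr \<tau>) s \<le> C"
    using words_with_bounded_cost[of d \<tau> "\<lambda>v. len (to_Z_power d v)"] assms(1) \<tau> len_pos by auto
  then obtain w where w: "\<And>n. set (w n) \<subseteq> {..<d}" "\<And>n. length (w n) = n"
    and cost: "\<And>n. word_cost (\<lambda>v. len (to_Z_power d v) powr \<tau>) (w n) \<le> C"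
    by metis
  define \<gamma> where "\<gamma> n = to_Z_power d (count_list (w n))" for n
  have \<gamma>G: "\<gamma> n \<in> carrier (Z_power d)" for n by (simp add: \<gamma>_def)
  have inj: "inj \<gamma>"
  proof (rule injI)
    fix m n assume "\<gamma> m = \<gamma> n"
    then have "(\<Sum>i<d. count_list (w m) i) = (\<Sum>i<d. count_list (w n) i)"
      by (intro sum.cong) (auto simp: \<gamma>_def to_Z_power_eq_iff)
    then show "m = n"
      using w by (simp add: sum_count_set)
  qed

  define W where "W = word_map (\<lambda>i. F (to_Z_power d (count_list [i])))"
  have W: "W s y - W s x = F (to_Z_power d (count_list s)) y - F (to_Z_power d (count_list s)) x"
    if "set s \<subseteq> {..<d}" for s x y
  proof -
    have "is_lift (W s) (\<phi> (to_Z_power d (count_list s)))"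
      unfolding W_def by (rule word_map_is_lift[OF assms(3) F(1) that]) simp
    then obtain k :: int where "\<And>x. W s x = F (to_Z_power d (count_list s)) x + of_int k"
      using is_lift_unique[OF F(1)] to_Z_power_closed by metis
    then show ?thesis by simp
  qed
  define \<kappa>' where "\<kappa>' = (\<Sum>i<d. \<kappa> (to_Z_power d (count_list [i])))"
  have \<kappa>': "\<kappa>' \<ge> 0" "\<And>i. i < d \<Longrightarrow> \<kappa> (to_Z_power d (count_list [i])) \<le> \<kappa>'"
    unfolding \<kappa>'_def using \<kappa>(1) by (auto intro: sum_nonneg member_le_sum simp del: count_list.simps)
  define \<delta> where "\<delta> = (b - a) * exp (- (\<kappa>' * 2 powr \<tau> * C)) / 2"
  have \<delta>: "\<delta> > 0" using ab by (simp add: \<delta>_def)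
  have bound: "F (\<gamma> n) (b + \<delta>) - F (\<gamma> n) (a - \<delta>) \<le> 2 * len (\<gamma> n)" for n
  proof -
    have "(\<Sum>t\<leftarrow>suffixes (w n). (W t b - W t a) powr \<tau>)
        = word_cost (\<lambda>v. len (to_Z_power d v) powr \<tau>) (w n)"
      unfolding word_cost_def len_def
    proof (intro arg_cong[of _ _ sum_list] map_cong refl)
      fix t assume "t \<in> set (suffixes (w n))"
      then have "set t \<subseteq> {..<d}" using w(1)[of n] set_mono_suffix by fastforce
      then show "(W t b - W t a) powr \<tau> = (F (to_Z_power d (count_list t)) b - F (to_Z_power d (count_list t)) a) powr \<tau>"
        by (simp add: W)
    qed
    then have "(\<Sum>t\<leftarrow>suffixes (w n). (W t b - W t a) powr \<tau>) \<le> C"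
      using cost by simp
    then have "W (w n) (b + \<delta>) - W (w n) (a - \<delta>) \<le> 2 * (W (w n) b - W (w n) a)"
      unfolding W_def
    proof (rule word_map_enlarged_interval_le[OF ab \<tau>0 \<kappa>'(1) F' _ w(1) _ \<delta>_def, rotated -1])
      fix i x y assume "i < d"
      have "\<bar>ln (F' (to_Z_power d (count_list [i])) x) - ln (F' (to_Z_power d (count_list [i])) y)\<bar>
          \<le> \<kappa> (to_Z_power d (count_list [i])) * \<bar>x - y\<bar> powr \<tau>"
        by (rule \<kappa>(2)) simp
      also have "\<dots> \<le> \<kappa>' * \<bar>x - y\<bar> powr \<tau>"
        using \<kappa>'(2)[OF \<open>i < d\<close>] by (rule mult_right_mono) simp
      finally show "\<bar>ln (F' (to_Z_power d (count_list [i])) x) - ln (F' (to_Z_power d (count_list [i])) y)\<bar>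
          \<le> \<kappa>' * \<bar>x - y\<bar> powr \<tau>" .
    qed simp_all
    then show ?thesis
      unfolding W[OF w(1)] by (simp add: \<gamma>_def len_def)
  qed
  have "summable (\<lambda>n. len (\<gamma> n))"
  proof (rule summableI_nonneg_bounded)
    show "len (\<gamma> n) \<ge> 0" for n using len_pos[OF \<gamma>G] by (simp add: less_imp_le)
    show "(\<Sum>n<N. len (\<gamma> n)) \<le> 1" for N
    proof -
      have "(\<Sum>n<N. len (\<gamma> n)) = sum len (\<gamma> ` {..<N})"
        using inj by (subst sum.reindex) (auto intro: inj_on_subset)
      also have "\<dots> \<le> 1"
        unfolding len_def by (rule sum1) (use \<gamma>G in auto)
      finally show ?thesis .
    qed
  qed
  then have "(\<lambda>n. 2 * len (\<gamma> n)) \<longlonglongrightarrow> 0"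
    by (intro tendsto_mult_right_zero summable_LIMSEQ_zero)
  then have "(\<lambda>n. F (\<gamma> n) (b + \<delta>) - F (\<gamma> n) (a - \<delta>)) \<longlonglongrightarrow> 0"
  proof (rule tendsto_sandwich[OF _ _ tendsto_const, rotated 2])
    have "F (\<gamma> n) (a - \<delta>) < F (\<gamma> n) (b + \<delta>)" for n
      using F(2)[OF \<gamma>G[of n]] ab \<delta> by (simp add: strict_mono_def)
    then show "\<forall>\<^sub>F n in sequentially. 0 \<le> F (\<gamma> n) (b + \<delta>) - F (\<gamma> n) (a - \<delta>)"
      by (simp add: less_imp_le)
  qed (simp add: bound)
  moreover have "range \<gamma> \<subseteq> carrier (Z_power d)" using \<gamma>G by auto
  ultimately show False
    using no_contraction[OF \<delta> _ inj] by blast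
qed

end
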